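(* Let $K$ be a compact convex set in a locally convex space, let $F\subset K$ be a closed split face, and let $J=\{a\in A(K): a|_F=0\}$, with quotient map $\pi:A(K)\to A(K)/J$. Suppose that for every order unit space $E$ and every non-negative bounded linear operator $T:E\to A(K)/J$ there is a non-negative bounded linear operator $T':E\to A(K)$ with $\pi\circ T'=T$ and $\|T'\|=\|T\|$. Then there exists an affine continuous map $\phi:K\to F$ with $\phi(k)=k$ for all $k\in F$. Consequently $(A(K),J)$ has the quotient lifting property.
   Context: $A(K)$ denotes the order unit space of real-valued affine continuous functions on $K$, with the supremum norm, pointwise order and order unit $1$. A face $F$ of $K$ is a split face if its complementary face $F'$ (the union of all faces of $K$ disjoint from $F$) is convex and every $k\in K\setminus(F\cup F')$ has a unique representation $k=\lambda y+(1-\lambda)z$ with $y\in F$, $z\in F'$, $0<\lambda<1$. For a closed split face, $A(K)/J$ is identified isometrically and order-isomorphically with $A(F)$ via $\pi(a)\mapsto a|_F$; this gives the order on $A(K)/J$. For a Banach space $X$ and closed subspace $J$, $(X,J)$ has the quotient lifting property (QLP) if for every Banach space $Y$ and every bounded linear $S:Y\to X/J$ there is a bounded linear $T:Y\to X$ with $\pi\circ T=S$ and $\|T\|=\|S\|$. *)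

theory Defs
  imports "HOL-Analysis.Analysis"
begin

definition locally_convex_space :: "'a::real_vector topology \<Rightarrow> bool" where
  "locally_convex_space T \<longleftrightarrow>
     topspace T = UNIV \<and> Hausdorff_space T \<and>
     continuous_map (prod_topology T T) T (\<lambda>(x, y). x + y) \<and>
     continuous_map (prod_topology euclideanreal T) T (\<lambda>(c, x). c *\<^sub>R x) \<and>
     (\<forall>U. openin T U \<and> 0 \<in> U \<longrightarrow> (\<exists>V. openin T V \<and> convex V \<and> 0 \<in> V \<and> V \<subseteq> U))"

definition aff_on :: "'a::real_vector set \<Rightarrow> ('a \<Rightarrow> 'b::real_vector) \<Rightarrow> bool" where
  "aff_on K f \<longleftrightarrow> (\<forall>x\<in>K. \<forall>y\<in>K. \<forall>t\<in>{0..1::real}.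
      f ((1 - t) *\<^sub>R x + t *\<^sub>R y) = (1 - t) *\<^sub>R f x + t *\<^sub>R f y)"

definition face :: "'a::real_vector set \<Rightarrow> 'a set \<Rightarrow> bool" where
  "face K F \<longleftrightarrow> F \<subseteq> K \<and> convex F \<and>
     (\<forall>x\<in>K. \<forall>y\<in>K. \<forall>t::real. 0 < t \<and> t < 1 \<and> t *\<^sub>R x + (1 - t) *\<^sub>R y \<in> F \<longrightarrow> x \<in> F \<and> y \<in> F)"

definition compl_face :: "'a::real_vector set \<Rightarrow> 'a set \<Rightarrow> 'a set" where
  "compl_face K F = \<Union>{G. face K G \<and> G \<inter> F = {}}"

definition split_face :: "'a::real_vector set \<Rightarrow> 'a set \<Rightarrow> bool" where
  "split_face K F \<longleftrightarrow> face K F \<and> convex (compl_face K F) \<and>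
     (\<forall>k\<in>K - (F \<union> compl_face K F).
        \<exists>!p. (case p of (t, y, z) \<Rightarrow>
               0 < t \<and> t < (1::real) \<and> y \<in> F \<and> z \<in> compl_face K F \<and>
               k = t *\<^sub>R y + (1 - t) *\<^sub>R z))"

definition AK :: "'a::real_vector topology \<Rightarrow> 'a set \<Rightarrow> ('a \<Rightarrow> real) set" where
  "AK T K = {a. continuous_map (subtopology T K) euclideanreal a \<and> aff_on K a \<and>
                (\<forall>x. x \<notin> K \<longrightarrow> a x = 0)}"

definition supK :: "'a set \<Rightarrow> ('a \<Rightarrow> real) \<Rightarrow> real" where
  "supK K a = Sup ((\<lambda>x. \<bar>a x\<bar>) ` K)"

text \<open>Restriction to F (extensional).  The quotient map \<pi> : A(K) \<rightarrow> A(K)/J, with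
  J = {a \<in> A(K). a|F = 0}, is modelled by a \<mapsto> restr F a: the coset a + J corresponds
  bijectively and linearly to restr F a.  The quotient space is restr F ` AK T K.\<close>
definition restr :: "'a set \<Rightarrow> ('a \<Rightarrow> real) \<Rightarrow> ('a \<Rightarrow> real)" where
  "restr F a = (\<lambda>x. if x \<in> F then a x else 0)"

definition Jideal :: "'a::real_vector topology \<Rightarrow> 'a set \<Rightarrow> 'a set \<Rightarrow> ('a \<Rightarrow> real) set" where
  "Jideal T K F = {a \<in> AK T K. \<forall>x\<in>F. a x = 0}"

definition quot :: "'a::real_vector topology \<Rightarrow> 'a set \<Rightarrow> 'a set \<Rightarrow> ('a \<Rightarrow> real) set" where
  "quot T K F = restr F ` AK T K"

definition qnorm :: "'a::real_vector topology \<Rightarrow> 'a set \<Rightarrow> 'a set \<Rightarrow> ('a \<Rightarrow> real) \<Rightarrow> real" where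
  "qnorm T K F g = Inf {supK K a | a. a \<in> AK T K \<and> restr F a = g}"

definition opnorm_on :: "'x set \<Rightarrow> ('x \<Rightarrow> real) \<Rightarrow> ('z \<Rightarrow> real) \<Rightarrow> ('x \<Rightarrow> 'z) \<Rightarrow> real" where
  "opnorm_on D nin nout f = Inf {C. C \<ge> 0 \<and> (\<forall>x\<in>D. nout (f x) \<le> C * nin x)}"

record 'e ous =
  oc :: "'e set"
  oadd :: "'e \<Rightarrow> 'e \<Rightarrow> 'e"
  osmul :: "real \<Rightarrow> 'e \<Rightarrow> 'e"
  ozero :: 'e
  ole :: "'e \<Rightarrow> 'e \<Rightarrow> bool"
  ounit :: 'e

definition order_unit_space :: "'e ous \<Rightarrow> bool" where
  "order_unit_space E \<longleftrightarrow>
    ozero E \<in> oc E \<and> ounit E \<in> oc E \<and>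
    (\<forall>x\<in>oc E. \<forall>y\<in>oc E. oadd E x y \<in> oc E) \<and>
    (\<forall>c. \<forall>x\<in>oc E. osmul E c x \<in> oc E) \<and>
    (\<forall>x\<in>oc E. \<forall>y\<in>oc E. \<forall>z\<in>oc E. oadd E (oadd E x y) z = oadd E x (oadd E y z)) \<and>
    (\<forall>x\<in>oc E. \<forall>y\<in>oc E. oadd E x y = oadd E y x) \<and>
    (\<forall>x\<in>oc E. oadd E (ozero E) x = x) \<and>
    (\<forall>x\<in>oc E. oadd E x (osmul E (-1) x) = ozero E) \<and>
    (\<forall>c. \<forall>x\<in>oc E. \<forall>y\<in>oc E. osmul E c (oadd E x y) = oadd E (osmul E c x) (osmul E c y)) \<and>
    (\<forall>c d. \<forall>x\<in>oc E. osmul E (c + d) x = oadd E (osmul E c x) (osmul E d x)) \<and>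
    (\<forall>c d. \<forall>x\<in>oc E. osmul E c (osmul E d x) = osmul E (c * d) x) \<and>
    (\<forall>x\<in>oc E. osmul E 1 x = x) \<and>
    \<comment> \<open>partial order compatible with the vector structure\<close>
    (\<forall>x\<in>oc E. ole E x x) \<and>
    (\<forall>x\<in>oc E. \<forall>y\<in>oc E. \<forall>z\<in>oc E. ole E x y \<and> ole E y z \<longrightarrow> ole E x z) \<and>
    (\<forall>x\<in>oc E. \<forall>y\<in>oc E. ole E x y \<and> ole E y x \<longrightarrow> x = y) \<and>
    (\<forall>x\<in>oc E. \<forall>y\<in>oc E. \<forall>z\<in>oc E. ole E x y \<longrightarrow> ole E (oadd E x z) (oadd E y z)) \<and>
    (\<forall>c. \<forall>x\<in>oc E. \<forall>y\<in>oc E. c \<ge> 0 \<and> ole E x y \<longrightarrow> ole E (osmul E c x) (osmul E c y)) \<and>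
    \<comment> \<open>the unit is an order unit\<close>
    (\<forall>x\<in>oc E. \<exists>r>0. ole E (osmul E (-r) (ounit E)) x \<and> ole E x (osmul E r (ounit E))) \<and>
    \<comment> \<open>Archimedean\<close>
    (\<forall>x\<in>oc E. (\<forall>r>0. ole E x (osmul E r (ounit E))) \<longrightarrow> ole E x (ozero E))"

definition ous_norm :: "'e ous \<Rightarrow> 'e \<Rightarrow> real" where
  "ous_norm E x = Inf {r. r > 0 \<and> ole E (osmul E (-r) (ounit E)) x \<and> ole E x (osmul E r (ounit E))}"

definition ous_linear :: "'e ous \<Rightarrow> ('e \<Rightarrow> ('a \<Rightarrow> real)) \<Rightarrow> bool" where
  "ous_linear E f \<longleftrightarrow> (\<forall>x\<in>oc E. \<forall>y\<in>oc E. \<forall>p. f (oadd E x y) p = f x p + f y p) \<and>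
                       (\<forall>c. \<forall>x\<in>oc E. \<forall>p. f (osmul E c x) p = c * f x p)"

text \<open>Positive norm-preserving lifting for order unit spaces.  Order unit spaces E range over
  all order unit spaces whose carrier lies in the (fixed, large) type 'a \<Rightarrow> real.\<close>
definition pos_lifting :: "'a::real_vector topology \<Rightarrow> 'a set \<Rightarrow> 'a set \<Rightarrow> bool" where
  "pos_lifting T K F \<longleftrightarrow>
    (\<forall>E :: ('a \<Rightarrow> real) ous. \<forall>S :: ('a \<Rightarrow> real) \<Rightarrow> ('a \<Rightarrow> real).
       order_unit_space E \<and> ous_linear E S \<and> (\<forall>x\<in>oc E. S x \<in> quot T K F) \<and>
       (\<forall>x\<in>oc E. ole E (ozero E) x \<longrightarrow> (\<forall>p\<in>F. S x p \<ge> 0)) \<and>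
       (\<exists>C. \<forall>x\<in>oc E. qnorm T K F (S x) \<le> C * ous_norm E x)
     \<longrightarrow> (\<exists>S'. ous_linear E S' \<and> (\<forall>x\<in>oc E. S' x \<in> AK T K) \<and>
              (\<forall>x\<in>oc E. ole E (ozero E) x \<longrightarrow> (\<forall>p\<in>K. S' x p \<ge> 0)) \<and>
              (\<exists>C. \<forall>x\<in>oc E. supK K (S' x) \<le> C * ous_norm E x) \<and>
              (\<forall>x\<in>oc E. restr F (S' x) = S x) \<and>
              opnorm_on (oc E) (ous_norm E) (supK K) S' =
                opnorm_on (oc E) (ous_norm E) (qnorm T K F) S))"

definition qlp :: "'a::real_vector topology \<Rightarrow> 'a set \<Rightarrow> 'a set \<Rightarrow> 'y::banach itself \<Rightarrow> bool" where
  "qlp T K F _ \<longleftrightarrow>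
    (\<forall>S :: 'y \<Rightarrow> ('a \<Rightarrow> real).
       (\<forall>y. S y \<in> quot T K F) \<and>
       (\<forall>y1 y2 p. S (y1 + y2) p = S y1 p + S y2 p) \<and> (\<forall>c y p. S (c *\<^sub>R y) p = c * S y p) \<and>
       (\<exists>C. \<forall>y. qnorm T K F (S y) \<le> C * norm y)
     \<longrightarrow> (\<exists>R :: 'y \<Rightarrow> ('a \<Rightarrow> real).
            (\<forall>y. R y \<in> AK T K) \<and>
            (\<forall>y1 y2 p. R (y1 + y2) p = R y1 p + R y2 p) \<and> (\<forall>c y p. R (c *\<^sub>R y) p = c * R y p) \<and>
            (\<exists>C. \<forall>y. supK K (R y) \<le> C * norm y) \<and>
            (\<forall>y. restr F (R y) = S y) \<and>
            opnorm_on UNIV norm (supK K) R = opnorm_on UNIV norm (qnorm T K F) S))"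

end

theory Submission
  imports Defs
begin

text \<open>Take \<open>E = A(K)/J\<close> and lift the identity. This requires that the quotient norm is the supremum
  norm on \<open>F\<close>: if \<open>\<bar>a\<bar> \<le> 1\<close> on \<open>F\<close>, uniqueness of the split decomposition puts the convex hull of
  \<open>K \<times> {-1}\<close> and the graph of \<open>a\<close> over \<open>F\<close> below the convex hull of \<open>K \<times> {1}\<close> and that graph, so a
  Hahn--Banach separation gives a \<open>b \<in> A(K)\<close> of norm at most \<open>1 + \<epsilon>\<close> that is within \<open>\<epsilon>\<close> of \<open>a\<close> on
  \<open>F\<close>, and a geometric series of such corrections makes it exact. The lift \<open>S\<close> of the identity
  satisfies \<open>S 1 \<le> 1\<close>, so for \<open>k \<in> K\<close> and a fixed \<open>p\<^sub>0 \<in> F\<close> the functional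
  \<open>a \<mapsto> S (a|F) k + (1 - S 1 k) a(p\<^sub>0)\<close> is a state on \<open>A(K)\<close> that is positive for the order of \<open>F\<close>.
  Such a state is evaluation at a point \<open>\<phi>(k) \<in> F\<close>. Composition with \<open>\<phi>\<close> then lifts all operators.\<close>

subsection \<open>Hahn--Banach separation\<close>

definition sublinear :: "('a::real_vector \<Rightarrow> real) \<Rightarrow> bool" where
  "sublinear p \<longleftrightarrow> (\<forall>x y. p (x + y) \<le> p x + p y) \<and> (\<forall>c x. 0 < c \<longrightarrow> p (c *\<^sub>R x) = c * p x)"

lemma sublinear_zero:
  assumes "sublinear p" shows "p 0 = 0"
proof -
  have "p (2 *\<^sub>R 0) = 2 * p 0" using assms unfolding sublinear_def by (meson zero_less_numeral)
  then show ?thesis by simp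
qed

lemma sublinear_uminus_ge:
  assumes "sublinear p" shows "- p (- x) \<le> p x"
proof -
  have "p (x + - x) \<le> p x + p (- x)" using assms unfolding sublinear_def by blast
  then show ?thesis using sublinear_zero[OF assms] by simp
qed

text \<open>A sublinear functional that is minimal among the sublinear functionals is linear: the
  functional \<open>r\<close> below is sublinear, lies below \<open>q\<close>, and satisfies \<open>r (- y) \<le> - q y\<close>.\<close>

lemma minimal_sublinear_linear:
  assumes q: "sublinear q" and min: "\<And>r. sublinear r \<Longrightarrow> r \<le> q \<Longrightarrow> r = q"
  shows "linear q"
proof -
  have add: "q (x + y) \<le> q x + q y" for x y using q unfolding sublinear_def by blast
  have hom: "0 < c \<Longrightarrow> q (c *\<^sub>R x) = c * q x" for c x using q unfolding sublinear_def by blast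
  have hom0: "0 \<le> c \<Longrightarrow> q (c *\<^sub>R x) = c * q x" for c x
    using hom sublinear_zero[OF q] by (cases "c = 0") auto
  have odd: "q (- y) = - q y" for y
  proof -
    define S where "S x = (\<lambda>t. q (x + t *\<^sub>R y) - t * q y) ` {0..}" for x
    define r where "r x = Inf (S x)" for x
    \<comment> \<open>Here \<open>t * q y = q (t *\<^sub>R y)\<close>, and
      \<open>t *\<^sub>R y\<close> is the sum of \<open>x + t *\<^sub>R y\<close> and
      \<open>- x\<close>. The bound does not depend on \<open>t\<close>, so the infimum
      \<open>r x\<close> is finite.\<close>
    have lb: "- q (- x) \<le> q (x + t *\<^sub>R y) - t * q y" if "t \<ge> 0" for x t
      using add[of "x + t *\<^sub>R y" "- x"] hom0[of t y] that by simp
    have bdd: "bdd_below (S x)" for x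
      unfolding S_def by (rule bdd_belowI2[of _ "- q (- x)"]) (use lb in auto)
    have ne: "S x \<noteq> {}" for x unfolding S_def by auto
    have r_le: "r x \<le> q (x + t *\<^sub>R y) - t * q y" if "t \<ge> 0" for x t
      unfolding r_def by (rule cInf_lower[OF _ bdd]) (use that in \<open>auto simp: S_def\<close>)
    have r_ge: "m \<le> r x" if "\<And>t. t \<ge> 0 \<Longrightarrow> m \<le> q (x + t *\<^sub>R y) - t * q y" for m x
      unfolding r_def by (rule cInf_greatest[OF ne]) (use that in \<open>auto simp: S_def\<close>)
    have r_add: "r (x + z) \<le> r x + r z" for x z
    proof -
      have "r (x + z) - (q (x + t *\<^sub>R y) - t * q y) \<le> r z" if t: "t \<ge> 0" for t
      proof (rule r_ge)
        fix s :: real assume s: "s \<ge> 0"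
        have "q (x + z + (t + s) *\<^sub>R y) \<le> q (x + t *\<^sub>R y) + q (z + s *\<^sub>R y)"
          using add[of "x + t *\<^sub>R y" "z + s *\<^sub>R y"] by (simp add: algebra_simps)
        then show "r (x + z) - (q (x + t *\<^sub>R y) - t * q y) \<le> q (z + s *\<^sub>R y) - s * q y"
          using r_le[of "t + s" "x + z"] s t by (simp add: algebra_simps)
      qed
      then have "r (x + z) - r z \<le> r x"
        by (intro r_ge) (simp add: algebra_simps)
      then show ?thesis by simp
    qed
    have r_hom_le: "c * r x \<le> r (c *\<^sub>R x)" if c: "c > 0" for c x
    proof (rule r_ge)
      fix t :: real assume t: "t \<ge> 0"
      have "c * r x \<le> c * (q (x + (t / c) *\<^sub>R y) - (t / c) * q y)"
        using r_le[of "t / c" x] c t by (intro mult_left_mono) auto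
      also have "\<dots> = q (c *\<^sub>R (x + (t / c) *\<^sub>R y)) - t * q y"
        using c by (subst hom) (auto simp: algebra_simps)
      also have "c *\<^sub>R (x + (t / c) *\<^sub>R y) = c *\<^sub>R x + t *\<^sub>R y"
        using c by (simp add: algebra_simps)
      finally show "c * r x \<le> q (c *\<^sub>R x + t *\<^sub>R y) - t * q y" .
    qed
    have r_hom: "r (c *\<^sub>R x) = c * r x" if c: "c > 0" for c x
    proof (rule antisym)
      have "(1 / c) * r (c *\<^sub>R x) \<le> r ((1 / c) *\<^sub>R c *\<^sub>R x)"
        using c by (intro r_hom_le) simp
      then show "r (c *\<^sub>R x) \<le> c * r x" using c by (simp add: field_simps)
    qed (rule r_hom_le[OF c])
    have "r = q"
      by (rule min) (use r_add r_hom r_le[of 0] in \<open>auto simp: sublinear_def le_fun_def\<close>)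
    moreover have "r (- y) \<le> - q y"
      using r_le[of 1 "- y"] sublinear_zero[OF q] by simp
    ultimately show ?thesis using sublinear_uminus_ge[OF q, of y] by simp
  qed
  show ?thesis
  proof (rule linearI)
    fix x y
    have "q (- x + - y) \<le> q (- x) + q (- y)" by (rule add)
    then have "- q (x + y) \<le> - q x - q y" using odd[of "x + y"] odd[of x] odd[of y] by simp
    then show "q (x + y) = q x + q y" using add[of x y] by linarith
  next
    fix c :: real and x
    show "q (c *\<^sub>R x) = c *\<^sub>R q x"
    proof (cases "c \<ge> 0")
      case False
      then have "q ((- c) *\<^sub>R x) = (- c) * q x" by (intro hom) simp
      then show ?thesis using odd[of "c *\<^sub>R x"] by simp
    qed (simp add: hom0)
  qed
qed

text \<open>Zorn's lemma, applied to the sublinear functionals below \<open>p\<close>, yields a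
  minimal one, and minimality forces linearity. The infimum of a chain is again sublinear because of
  any two members one lies below the other.\<close>

theorem linear_below_sublinear:
  fixes p :: "'a::real_vector \<Rightarrow> real"
  assumes p: "sublinear p"
  obtains f where "linear f" "\<And>x. f x \<le> p x"
proof -
  define A where "A = {q. sublinear q \<and> q \<le> p}"
  \<comment> \<open>The order is reversed, so that the maximal element supplied by
    \<open>predicate_Zorn\<close> is a minimal functional and an upper bound of a chain is a
    functional below all its members.\<close>
  have "\<exists>m\<in>A. \<forall>a\<in>A. a \<le> m \<longrightarrow> a = m"
  proof (rule predicate_Zorn)
    show "partial_order_on A (relation_of (\<lambda>x y. y \<le> x) A)"
      by (rule partial_order_on_relation_ofI) auto
  next
    fix C assume C: "C \<in> Chains (relation_of (\<lambda>x y. y \<le> x) A)"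
    show "\<exists>u\<in>A. \<forall>a\<in>C. u \<le> a"
    proof (cases "C = {}")
      case True
      then show ?thesis using p unfolding A_def by blast
    next
      case False
      have CA: "C \<subseteq> A" using C unfolding Chains_def relation_of_def by blast
      have tot: "a \<le> b \<or> b \<le> a" if "a \<in> C" "b \<in> C" for a b
        using C that unfolding Chains_def relation_of_def by blast
      define u where "u x = Inf ((\<lambda>a. a x) ` C)" for x
      \<comment> \<open>From \<open>a \<le> p\<close> follows
        \<open>- p (- x) \<le> - a (- x) \<le> a x\<close>, which keeps the infimum over the chain
        finite.\<close>
      have lb: "- p (- x) \<le> a x" if "a \<in> C" for a x
        using CA that sublinear_uminus_ge[of a x] unfolding A_def le_fun_def by (smt (verit) subsetD mem_Collect_eq)
      have u_le: "u x \<le> a x" if "a \<in> C" for a x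
        unfolding u_def by (rule cInf_lower) (use that lb in \<open>auto intro!: bdd_belowI2\<close>)
      have u_ge: "m \<le> u x" if "\<And>a. a \<in> C \<Longrightarrow> m \<le> a x" for m x
        unfolding u_def by (rule cInf_greatest) (use that False in auto)
      have u_add: "u (x + y) \<le> u x + u y" for x y
      proof -
        have "u (x + y) - a x \<le> b y" if ab: "a \<in> C" "b \<in> C" for a b
        proof -
          \<comment> \<open>Taking the smaller of \<open>a\<close> and \<open>b\<close> turns the
            mixed sum \<open>a x + b y\<close> into an upper bound for
            \<open>c x + c y\<close>.\<close>
          obtain c where c: "c \<in> C" "c \<le> a" "c \<le> b" using tot ab by blast
          then have "c (x + y) \<le> c x + c y" using CA unfolding A_def sublinear_def by blast
          then show ?thesis using c u_le[OF c(1), of "x + y"] unfolding le_fun_def by (smt (verit))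
        qed
        then have "u (x + y) - a x \<le> u y" if "a \<in> C" for a by (intro u_ge) (use that in auto)
        then have "u (x + y) - u y \<le> u x" by (intro u_ge) (simp add: algebra_simps)
        then show ?thesis by simp
      qed
      have hom: "a (c *\<^sub>R x) = c * a x" if "a \<in> C" "c > 0" for a c x
        using CA that unfolding A_def sublinear_def by blast
      have u_hom: "u (c *\<^sub>R x) = c * u x" if c: "c > 0" for c x
      proof (rule antisym)
        have "u (c *\<^sub>R x) / c \<le> u x"
          using u_le[of _ "c *\<^sub>R x"] c by (intro u_ge) (simp add: field_simps hom[OF _ c])
        then show "u (c *\<^sub>R x) \<le> c * u x" using c by (simp add: field_simps)
      next
        show "c * u x \<le> u (c *\<^sub>R x)"
          using u_le c by (intro u_ge) (simp add: hom)
      qed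
      have "u \<le> p"
      proof -
        obtain a where a: "a \<in> C" using False by blast
        then have "a \<le> p" using CA unfolding A_def by blast
        then show ?thesis using u_le[OF a] unfolding le_fun_def by (meson order_trans)
      qed
      then have "u \<in> A" using u_add u_hom unfolding A_def sublinear_def by blast
      then show ?thesis using u_le unfolding le_fun_def by blast
    qed
  qed
  then obtain m where m: "m \<in> A" and min: "\<And>a. a \<in> A \<Longrightarrow> a \<le> m \<Longrightarrow> a = m" by blast
  have "linear m"
    by (rule minimal_sublinear_linear) (use m min in \<open>auto simp: A_def intro: order_trans\<close>)
  then show ?thesis using m that unfolding A_def le_fun_def by blast
qed

section \<open>Locally convex topologies and continuous functionals\<close>

lemma lcs_topspace: "locally_convex_space T \<Longrightarrow> topspace T = UNIV"
  by (simp add: locally_convex_space_def)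

lemma lcs_continuous_add:
  assumes "locally_convex_space T" "continuous_map X T f" "continuous_map X T g"
  shows "continuous_map X T (\<lambda>x. f x + g x)"
proof -
  have "continuous_map X T ((\<lambda>(x, y). x + y) \<circ> (\<lambda>x. (f x, g x)))"
    by (rule continuous_map_compose[OF continuous_map_pairedI[OF assms(2,3)]])
       (use assms(1) in \<open>simp add: locally_convex_space_def\<close>)
  then show ?thesis by (simp add: o_def)
qed

lemma lcs_continuous_scaleR:
  assumes "locally_convex_space T" "continuous_map X euclideanreal f" "continuous_map X T g"
  shows "continuous_map X T (\<lambda>x. f x *\<^sub>R g x)"
proof -
  have "continuous_map X T ((\<lambda>(c, x). c *\<^sub>R x) \<circ> (\<lambda>x. (f x, g x)))"
    by (rule continuous_map_compose[OF continuous_map_pairedI[OF assms(2,3)]])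
       (use assms(1) in \<open>simp add: locally_convex_space_def\<close>)
  then show ?thesis by (simp add: o_def)
qed

lemma lcs_continuous_diff:
  assumes "locally_convex_space T" "continuous_map X T f" "continuous_map X T g"
  shows "continuous_map X T (\<lambda>x. f x - g x)"
  using lcs_continuous_add[OF assms(1,2) lcs_continuous_scaleR[OF assms(1) _ assms(3), of "\<lambda>_. -1"]]
  by simp

text \<open>By continuity of \<open>c \<mapsto> c *\<^sub>R x\<close> at 0, all sufficiently small
  multiples of \<open>x\<close> lie in \<open>V\<close>.\<close>

lemma lcs_absorbing:
  assumes T: "locally_convex_space T" and V: "openin T V" "0 \<in> V"
  obtains r where "r > 0" "x \<in> (\<lambda>v. r *\<^sub>R v) ` V"
proof -
  have "continuous_map euclideanreal T (\<lambda>c. c *\<^sub>R x)"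
    by (rule lcs_continuous_scaleR[OF T]) (use lcs_topspace[OF T] in auto)
  then have "openin euclideanreal {c \<in> topspace euclideanreal. c *\<^sub>R x \<in> V}"
    using V(1) by (rule openin_continuous_map_preimage)
  then have op: "open {c. c *\<^sub>R x \<in> V}" by simp
  have "0 \<in> {c. c *\<^sub>R x \<in> V}" using V by simp
  then obtain e where e: "e > 0" "\<And>c. \<bar>c\<bar> < e \<Longrightarrow> c *\<^sub>R x \<in> V"
    using op unfolding open_dist by (metis diff_0_right dist_real_def mem_Collect_eq)
  show ?thesis
  proof
    show "2 / e > 0" using e by simp
    show "x \<in> (\<lambda>v. (2 / e) *\<^sub>R v) ` V"
      by (rule image_eqI[of _ _ "(e / 2) *\<^sub>R x"]) (use e in auto)
  qed
qed

text \<open>A one-sided bound near 0 suffices: asking that both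
  \<open>(2 / e) *\<^sub>R (y - x)\<close> and its negative lie in \<open>V\<close> replaces
  symmetry of \<open>V\<close> and gives \<open>\<bar>f y - f x\<bar> \<le> e / 2\<close>.\<close>

lemma lcs_linear_continuous:
  fixes f :: "'a::real_vector \<Rightarrow> real"
  assumes T: "locally_convex_space T" and f: "linear f"
    and V: "openin T V" "0 \<in> V" and le: "\<And>v. v \<in> V \<Longrightarrow> f v \<le> 1"
  shows "continuous_map T euclideanreal f"
  unfolding continuous_map_def
proof (intro conjI allI impI)
  fix U assume "openin euclideanreal U"
  then have U: "open U" by simp
  show "openin T {x \<in> topspace T. f x \<in> U}"
  proof (subst openin_subopen, intro ballI)
    fix x assume "x \<in> {x \<in> topspace T. f x \<in> U}"
    then obtain e where e: "e > 0" "\<And>r. \<bar>r - f x\<bar> < e \<Longrightarrow> r \<in> U"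
      using U unfolding open_dist by (auto simp: dist_real_def)
    define g where "g s y = (s / e) *\<^sub>R (y - x)" for s y
    have g: "continuous_map T T (g s)" for s
      unfolding g_def
      by (intro lcs_continuous_scaleR[OF T] lcs_continuous_diff[OF T])
         (use lcs_topspace[OF T] continuous_map_id[of T] in \<open>auto simp: id_def\<close>)
    define W where "W = {y \<in> topspace T. g 2 y \<in> V} \<inter> {y \<in> topspace T. g (-2) y \<in> V}"
    have "openin T W" unfolding W_def using g V by (blast intro: openin_continuous_map_preimage)
    moreover have "x \<in> W" unfolding W_def g_def using V lcs_topspace[OF T] by simp
    moreover have "W \<subseteq> {x \<in> topspace T. f x \<in> U}"
    proof
      fix y assume "y \<in> W"
      then have "f (g 2 y) \<le> 1" "f (g (-2) y) \<le> 1" using le unfolding W_def by auto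
      then have "(2 / e) * (f y - f x) \<le> 1" "- (2 / e) * (f y - f x) \<le> 1"
        unfolding g_def by (simp_all only: linear_cmul[OF f] linear_diff[OF f] real_scaleR_def minus_divide_left)
      then have "\<bar>f y - f x\<bar> < e" using e(1) by (auto simp: field_simps abs_if)
      then show "y \<in> {x \<in> topspace T. f x \<in> U}" using e lcs_topspace[OF T] by auto
    qed
    ultimately show "\<exists>W. openin T W \<and> x \<in> W \<and> W \<subseteq> {x \<in> topspace T. f x \<in> U}" by blast
  qed
qed auto

text \<open>The functional \<open>q\<close> combines the gauge of \<open>V\<close> with the constraint on \<open>C\<close>, so that any linear
  minorant of \<open>q\<close> is both bounded on \<open>V\<close> and at least 1 on \<open>C\<close>.\<close>

lemma lcs_separate_open:
  fixes T :: "'a::real_vector topology"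
  assumes T: "locally_convex_space T" and C: "convex C" "C \<noteq> {}"
    and V: "openin T V" "convex V" "0 \<in> V" and disj: "V \<inter> C = {}"
  obtains f :: "'a \<Rightarrow> real" where "linear f" "continuous_map T euclideanreal f" "\<And>c. c \<in> C \<Longrightarrow> 1 \<le> f c"
proof -
  \<comment> \<open>With \<open>s = 0\<close> the values \<open>t\<close> are those of the gauge of
    \<open>V\<close>; a positive \<open>s\<close> lowers the value when a multiple of a point of
    \<open>C\<close> is added to \<open>x\<close>.\<close>
  define S where "S x = {t - s | t s c v. 0 < t \<and> 0 \<le> s \<and> c \<in> C \<and> v \<in> V \<and> x + s *\<^sub>R c = t *\<^sub>R v}" for x
  define q where "q x = Inf (S x)" for x
  have star: "a *\<^sub>R v \<in> V" if "v \<in> V" "0 \<le> a" "a \<le> 1" for a v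
    using convexD_alt[OF V(2) V(3) that(1), of a] that by simp
  have comb: "\<exists>c\<in>D. a *\<^sub>R x + b *\<^sub>R y = (a + b) *\<^sub>R c"
    if "convex D" "x \<in> D" "y \<in> D" "0 \<le> a" "0 \<le> b" for a b :: real and x y :: 'a and D
  proof (cases "a + b = 0")
    case True
    then have "a = 0" "b = 0" using that by auto
    then show ?thesis using that by auto
  next
    case False
    have "(a / (a + b)) *\<^sub>R x + (b / (a + b)) *\<^sub>R y \<in> D"
      using that False by (intro convexD) (auto simp: add_divide_distrib[symmetric])
    then show ?thesis
      by (rule bexI[rotated]) (use False in \<open>simp add: scaleR_add_right\<close>)
  qed
  \<comment> \<open>Write \<open>- x = r *\<^sub>R v0\<close>. If \<open>s > t + r\<close>, then
    \<open>s *\<^sub>R c = t *\<^sub>R v + r *\<^sub>R v0\<close> shows that \<open>c\<close> is a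
    point of \<open>V\<close> scaled by a factor below 1, so \<open>c\<close> lies in
    \<open>V\<close>, against disjointness. Hence \<open>- r\<close> is a lower bound.\<close>
  have bdd: "bdd_below (S x)" for x
  proof -
    obtain r v0 where r: "r > 0" and v0: "v0 \<in> V" "- x = r *\<^sub>R v0"
      using lcs_absorbing[OF T V(1,3), of "- x"] by blast
    have "- r \<le> t - s" if H: "0 < t" "0 \<le> s" "c \<in> C" "v \<in> V" "x + s *\<^sub>R c = t *\<^sub>R v" for t s c v
    proof (rule ccontr)
      assume "\<not> - r \<le> t - s"
      then have s: "s > t + r" by simp
      have "s *\<^sub>R c = t *\<^sub>R v + r *\<^sub>R v0" using H(5) v0(2) by (metis add_diff_cancel_left' diff_conv_add_uminus add.commute)
      then obtain w where w: "w \<in> V" "s *\<^sub>R c = (t + r) *\<^sub>R w"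
        using comb[OF V(2) H(4) v0(1), of t r] H r by auto
      then have "((t + r) / s) *\<^sub>R w \<in> V" using H(1) r s by (intro star) auto
      moreover have "c = ((t + r) / s) *\<^sub>R w"
        using w(2) s H(1) r by (metis (no_types, opaque_lifting) divide_inverse_commute less_add_same_cancel1 less_trans order_less_irrefl pos_add_strict scaleR_scaleR scaleR_one left_inverse)
      ultimately show False using disj H(3) by auto
    qed
    then show ?thesis unfolding S_def by (intro bdd_belowI[of _ "- r"]) auto
  qed
  obtain c0 where c0: "c0 \<in> C" using C by blast
  have ne: "S x \<noteq> {}" for x
  proof -
    obtain r v0 where "r > 0" "v0 \<in> V" "x = r *\<^sub>R v0"
      using lcs_absorbing[OF T V(1,3), of x] by blast
    then have "r - 0 \<in> S x" unfolding S_def using c0 by (intro CollectI exI[of _ r] exI[of _ "0::real"] exI[of _ c0] exI[of _ v0]) auto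
    then show ?thesis by blast
  qed
  have q_le: "q x \<le> t - s" if "0 < t" "0 \<le> s" "c \<in> C" "v \<in> V" "x + s *\<^sub>R c = t *\<^sub>R v" for x t s c v
    unfolding q_def by (rule cInf_lower[OF _ bdd]) (use that in \<open>auto simp: S_def\<close>)
  have q_ge: "m \<le> q x" if "\<And>t s c v. \<lbrakk>0 < t; 0 \<le> s; c \<in> C; v \<in> V; x + s *\<^sub>R c = t *\<^sub>R v\<rbrakk> \<Longrightarrow> m \<le> t - s" for m x
    unfolding q_def by (rule cInf_greatest[OF ne]) (use that in \<open>auto simp: S_def\<close>)
  have "sublinear q"
    unfolding sublinear_def
  proof (intro conjI allI impI)
    fix x y
    have "q (x + y) - (t - s) \<le> q y"
      if H: "0 < t" "0 \<le> s" "c \<in> C" "v \<in> V" "x + s *\<^sub>R c = t *\<^sub>R v" for t s c v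
    proof (rule q_ge)
      fix t' s' c' v' assume H': "0 < t'" "0 \<le> s'" "c' \<in> C" "v' \<in> V" "y + s' *\<^sub>R c' = t' *\<^sub>R v'"
      obtain d where d: "d \<in> C" "s *\<^sub>R c + s' *\<^sub>R c' = (s + s') *\<^sub>R d" using comb[OF C(1)] H H' by meson
      obtain w where w: "w \<in> V" "t *\<^sub>R v + t' *\<^sub>R v' = (t + t') *\<^sub>R w" using comb[OF V(2)] H H' by (meson less_imp_le)
      have "x + y + (s + s') *\<^sub>R d = (t + t') *\<^sub>R w"
        unfolding d(2)[symmetric] w(2)[symmetric] H(5)[symmetric] H'(5)[symmetric] by (simp add: algebra_simps)
      then have "q (x + y) \<le> (t + t') - (s + s')" using H H' d w by (intro q_le) auto
      then show "q (x + y) - (t - s) \<le> t' - s'" by simp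
    qed
    then have "q (x + y) - q y \<le> q x" by (intro q_ge) (smt (verit))
    then show "q (x + y) \<le> q x + q y" by simp
  next
    fix a :: real and x assume a: "0 < a"
    have le: "q (b *\<^sub>R y) \<le> b * q y" if b: "b > 0" for b y
    proof -
      have "q (b *\<^sub>R y) / b \<le> q y"
      proof (rule q_ge)
        fix t s c v assume H: "0 < t" "0 \<le> s" "c \<in> C" "v \<in> V" "y + s *\<^sub>R c = t *\<^sub>R v"
        have "b *\<^sub>R y + (b * s) *\<^sub>R c = (b * t) *\<^sub>R v"
          using arg_cong[OF H(5), of "\<lambda>z. b *\<^sub>R z"] by (simp add: scaleR_add_right)
        then have "q (b *\<^sub>R y) \<le> b * t - b * s" using H b by (intro q_le) auto
        then show "q (b *\<^sub>R y) / b \<le> t - s" using b by (simp add: field_simps)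
      qed
      then show ?thesis using b by (simp add: field_simps)
    qed
    have "q ((1 / a) *\<^sub>R a *\<^sub>R x) \<le> (1 / a) * q (a *\<^sub>R x)" using a by (intro le) simp
    then show "q (a *\<^sub>R x) = a * q x" using le[OF a, of x] a by (simp add: field_simps)
  qed
  then obtain f where f: "linear f" and fq: "\<And>x. f x \<le> q x" using linear_below_sublinear by blast
  have "f v \<le> 1" if "v \<in> V" for v
    using fq[of v] q_le[of 1 0 c0 v v] c0 that by simp
  then have "continuous_map T euclideanreal f" by (rule lcs_linear_continuous[OF T f V(1,3)])
  moreover have "1 \<le> f c" if c: "c \<in> C" for c
  proof (rule field_le_epsilon)
    fix e :: real assume e: "0 < e"
    \<comment> \<open>The representation used is \<open>- c + 1 *\<^sub>R c = e *\<^sub>R 0\<close>;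
      the scale \<open>e\<close> must be positive but may be arbitrarily small.\<close>
    have "f (- c) \<le> e - 1" using fq[of "- c"] q_le[of e 1 c 0 "- c"] e c V(3) by simp
    then show "1 \<le> f c + e" using linear_neg[OF f, of c] by simp
  qed
  ultimately show ?thesis using f that by blast
qed

text \<open>The complement of \<open>C\<close> is an open neighbourhood of 0 and therefore contains
  an open convex one, which is disjoint from \<open>C\<close>.\<close>

lemma lcs_separate_closed:
  fixes T :: "'a::real_vector topology"
  assumes T: "locally_convex_space T" and C: "convex C" "closedin T C" "0 \<notin> C"
  obtains f :: "'a \<Rightarrow> real" where "linear f" "continuous_map T euclideanreal f" "\<And>c. c \<in> C \<Longrightarrow> 1 \<le> f c"
proof (cases "C = {}")
  case True
  have "linear (\<lambda>x::'a. 0::real)" by (rule linear_zero)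
  then show ?thesis using True that[of "\<lambda>_. 0"] by auto
next
  case False
  have op: "openin T (topspace T - C)" using C by blast
  moreover have "0 \<in> topspace T - C" using C lcs_topspace[OF T] by auto
  ultimately obtain V where "openin T V" "convex V" "0 \<in> V" "V \<subseteq> topspace T - C"
    using T unfolding locally_convex_space_def by blast
  then show ?thesis using lcs_separate_open[OF T C(1) False, of V] that by blast
qed

text \<open>Graphs of affine functions live in this product, and the extension argument separates
  convex sets there.\<close>

lemma lcs_prod_real:
  fixes T :: "'a::real_vector topology"
  assumes T: "locally_convex_space T"
  shows "locally_convex_space (prod_topology T euclideanreal)"
  unfolding locally_convex_space_def
proof (intro conjI allI impI)
  let ?P = "prod_topology T euclideanreal"
  show "topspace ?P = UNIV" using lcs_topspace[OF T] by simp
  show "Hausdorff_space ?P"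
    using T by (simp add: Hausdorff_space_prod_topology locally_convex_space_def)
  have c: "continuous_map (prod_topology ?P ?P) T (\<lambda>z. fst (fst z))" "continuous_map (prod_topology ?P ?P) T (\<lambda>z. fst (snd z))"
    "continuous_map (prod_topology ?P ?P) euclideanreal (\<lambda>z. snd (fst z))" "continuous_map (prod_topology ?P ?P) euclideanreal (\<lambda>z. snd (snd z))"
    using continuous_map_compose[OF continuous_map_fst continuous_map_fst]
      continuous_map_compose[OF continuous_map_snd continuous_map_fst]
      continuous_map_compose[OF continuous_map_fst continuous_map_snd]
      continuous_map_compose[OF continuous_map_snd continuous_map_snd] by (fastforce simp: o_def)+
  have "continuous_map (prod_topology ?P ?P) ?P (\<lambda>z. (fst (fst z) + fst (snd z), snd (fst z) + snd (snd z)))"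
    by (intro continuous_map_pairedI lcs_continuous_add[OF T] continuous_map_add c)
  then show "continuous_map (prod_topology ?P ?P) ?P (\<lambda>(x, y). x + y)"
    by (simp add: case_prod_unfold plus_prod_def)
  have d: "continuous_map (prod_topology euclideanreal ?P) T (\<lambda>z. fst (snd z))" 
    "continuous_map (prod_topology euclideanreal ?P) euclideanreal (\<lambda>z. snd (snd z))"
    using continuous_map_compose[OF continuous_map_snd continuous_map_fst]
      continuous_map_compose[OF continuous_map_snd continuous_map_snd] by (fastforce simp: o_def)+
  have "continuous_map (prod_topology euclideanreal ?P) ?P (\<lambda>z. (fst z *\<^sub>R fst (snd z), fst z * snd (snd z)))"
    by (intro continuous_map_pairedI lcs_continuous_scaleR[OF T] continuous_map_real_mult d continuous_map_fst)
  then show "continuous_map (prod_topology euclideanreal ?P) ?P (\<lambda>(c, x). c *\<^sub>R x)"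
    by (simp add: case_prod_unfold scaleR_prod_def)
next
  fix U :: "('a \<times> real) set" assume "openin (prod_topology T euclideanreal) U \<and> 0 \<in> U"
  then obtain A B where AB: "openin T A" "openin euclideanreal B" "0 \<in> A" "0 \<in> B" "A \<times> B \<subseteq> U"
    unfolding openin_prod_topology_alt zero_prod_def by meson
  obtain V where V: "openin T V" "convex V" "0 \<in> V" "V \<subseteq> A"
    using T AB unfolding locally_convex_space_def by blast
  obtain e where e: "e > 0" "ball 0 e \<subseteq> B" using AB by (auto simp: open_contains_ball)
  show "\<exists>V. openin (prod_topology T euclideanreal) V \<and> convex V \<and> 0 \<in> V \<and> V \<subseteq> U"
  proof (intro exI conjI)
    show "openin (prod_topology T euclideanreal) (V \<times> ball (0::real) e)"
      using V by (simp add: openin_prod_Times_iff)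
    show "convex (V \<times> ball (0::real) e)" using V convex_ball by (intro convex_Times)
    show "0 \<in> V \<times> ball (0::real) e" using V e by (simp add: zero_prod_def)
    show "V \<times> ball (0::real) e \<subseteq> U" using V e AB by blast
  qed
qed

subsection \<open>Joins of convex sets\<close>

text \<open>The point \<open>c\<close> is chosen before \<open>f\<close>, so one point serves the
  vector identity and all affine functions at once. Unnormalised weights absorb the degenerate case
  \<open>a + b = 0\<close>, where any point will do.\<close>

lemma convex_cone_comb:
  fixes x y :: "'a::real_vector"
  assumes "convex D" "x \<in> D" "y \<in> D" "0 \<le> a" "0 \<le> b"
  obtains c where "c \<in> D" "a *\<^sub>R x + b *\<^sub>R y = (a + b) *\<^sub>R c"
    "\<And>f :: 'a \<Rightarrow> real. aff_on D f \<Longrightarrow> a * f x + b * f y = (a + b) * f c"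
proof (cases "a + b = 0")
  case True
  then have "a = 0" "b = 0" using assms by auto
  then show ?thesis using assms that[of x] by auto
next
  case False
  let ?t = "b / (a + b)"
  let ?c = "(1 - ?t) *\<^sub>R x + ?t *\<^sub>R y"
  have t: "?t \<in> {0..1}" "1 - ?t = a / (a + b)" using assms False by (auto simp: field_simps)
  show ?thesis
  proof (rule that[of ?c])
    show "?c \<in> D" using convexD_alt[OF assms(1-3), of ?t] t by simp
    show "a *\<^sub>R x + b *\<^sub>R y = (a + b) *\<^sub>R ?c"
      unfolding t(2) using False by (simp add: scaleR_add_right)
    show "a * f x + b * f y = (a + b) * f ?c" if "aff_on D f" for f :: "'a \<Rightarrow> real"
    proof -
      have "f ?c = (1 - ?t) * f x + ?t * f y"
        using that assms(2,3) t(1) unfolding aff_on_def real_scaleR_def by blast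
      then show ?thesis unfolding t(2) using False by (simp add: distrib_left)
    qed
  qed
qed

text \<open>For nonempty convex sets this is the convex hull of the union. Using only one point from
  each set exhibits it as an image of a product with the unit interval.\<close>

definition join :: "'a::real_vector set \<Rightarrow> 'a set \<Rightarrow> 'a set" where
  "join P Q = (\<lambda>(l, p, q). l *\<^sub>R p + (1 - l) *\<^sub>R q) ` ({0..1::real} \<times> P \<times> Q)"

lemma joinE:
  assumes "x \<in> join P Q"
  obtains l p q where "x = l *\<^sub>R p + (1 - l) *\<^sub>R q" "0 \<le> l" "l \<le> 1" "p \<in> P" "q \<in> Q"
  using assms unfolding join_def by auto

text \<open>The weights falling on \<open>P\<close> and those falling on \<open>Q\<close> are
  collected separately, and each group is merged into a single point.\<close>

lemma convex_join:
  assumes P: "convex P" and Q: "convex Q"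
  shows "convex (join P Q)"
proof (rule convexI)
  fix x y and u v :: real
  assume xj: "x \<in> join P Q" and yj: "y \<in> join P Q" and uv: "0 \<le> u" "0 \<le> v" "u + v = 1"
  from xj obtain l p q where x: "x = l *\<^sub>R p + (1 - l) *\<^sub>R q" "0 \<le> l" "l \<le> 1" "p \<in> P" "q \<in> Q"
    by (rule joinE)
  from yj obtain m p' q' where y: "y = m *\<^sub>R p' + (1 - m) *\<^sub>R q'" "0 \<le> m" "m \<le> 1" "p' \<in> P" "q' \<in> Q"
    by (rule joinE)
  have nonneg: "0 \<le> u * l" "0 \<le> v * m" "0 \<le> u * (1 - l)" "0 \<le> v * (1 - m)" using x y uv by auto
  obtain p'' where p'': "p'' \<in> P" "(u * l) *\<^sub>R p + (v * m) *\<^sub>R p' = (u * l + v * m) *\<^sub>R p''"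
    using convex_cone_comb[OF P x(4) y(4) nonneg(1,2)] by blast
  obtain q'' where q'': "q'' \<in> Q"
    "(u * (1 - l)) *\<^sub>R q + (v * (1 - m)) *\<^sub>R q' = (u * (1 - l) + v * (1 - m)) *\<^sub>R q''"
    using convex_cone_comb[OF Q x(5) y(5) nonneg(3,4)] by blast
  have s: "u * (1 - l) + v * (1 - m) = 1 - (u * l + v * m)" using uv by (simp add: algebra_simps)
  have "u *\<^sub>R x + v *\<^sub>R y = ((u * l) *\<^sub>R p + (v * m) *\<^sub>R p') + ((u * (1 - l)) *\<^sub>R q + (v * (1 - m)) *\<^sub>R q')"
    unfolding x y by (simp add: algebra_simps)
  also have "\<dots> = (u * l + v * m) *\<^sub>R p'' + (1 - (u * l + v * m)) *\<^sub>R q''"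
    unfolding p'' q'' s ..
  finally have *: "u *\<^sub>R x + v *\<^sub>R y = (u * l + v * m) *\<^sub>R p'' + (1 - (u * l + v * m)) *\<^sub>R q''" .
  have "u * l + v * m \<le> u * 1 + v * 1" using x y uv by (intro add_mono mult_left_mono) auto
  then have "u * l + v * m \<in> {0..1}" using x y uv by simp
  then show "u *\<^sub>R x + v *\<^sub>R y \<in> join P Q"
    unfolding join_def * using p''(1) q''(1) by (intro image_eqI[of _ _ "(u * l + v * m, p'', q'')"]) auto
qed

lemma compactin_join:
  assumes T: "locally_convex_space T" and P: "compactin T P" and Q: "compactin T Q"
  shows "compactin T (join P Q)"
  unfolding join_def
proof (rule image_compactin)
  let ?X = "prod_topology euclideanreal (prod_topology T T)"
  show "compactin ?X ({0..1::real} \<times> P \<times> Q)"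
    using P Q by (simp add: compactin_Times)
  have c: "continuous_map ?X T (\<lambda>z. fst (snd z))" "continuous_map ?X T (\<lambda>z. snd (snd z))"
    using continuous_map_compose[OF continuous_map_snd continuous_map_fst]
      continuous_map_compose[OF continuous_map_snd continuous_map_snd] by (fastforce simp: o_def)+
  have "continuous_map ?X T (\<lambda>z. fst z *\<^sub>R fst (snd z) + (1 - fst z) *\<^sub>R snd (snd z))"
    by (intro lcs_continuous_add[OF T] lcs_continuous_scaleR[OF T] c continuous_map_fst
        continuous_map_diff) auto
  then show "continuous_map ?X T (\<lambda>(l, p, q). l *\<^sub>R p + (1 - l) *\<^sub>R q)"
    by (simp add: case_prod_unfold)
qed

text \<open>The difference set \<open>B - A\<close> is compact, hence closed in a Hausdorff space,
  and it misses 0; a functional that is at least 1 on it gives the gap.\<close>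

lemma lcs_separate_compact:
  fixes T :: "'a::real_vector topology"
  assumes T: "locally_convex_space T" and A: "compactin T A" "convex A" and B: "compactin T B" "convex B"
    and disj: "A \<inter> B = {}"
  obtains f :: "'a \<Rightarrow> real" where "linear f" "continuous_map T euclideanreal f"
    "\<And>a b. a \<in> A \<Longrightarrow> b \<in> B \<Longrightarrow> f a + 1 \<le> f b"
proof -
  define C where "C = (\<lambda>(x, y). x - y) ` (B \<times> A)"
  have "compactin (prod_topology T T) (B \<times> A)" using A B by (simp add: compactin_Times)
  moreover have "continuous_map (prod_topology T T) T (\<lambda>(x, y). x - y)"
    using lcs_continuous_diff[OF T continuous_map_fst continuous_map_snd]
    by (simp add: case_prod_unfold)
  ultimately have "compactin T C" unfolding C_def by (rule image_compactin)
  then have "closedin T C"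
    using T by (intro compactin_imp_closedin) (auto simp: locally_convex_space_def)
  moreover have "C = (\<Union>x\<in>B. \<Union>y\<in>A. {x - y})" unfolding C_def by auto
  then have "convex C" using convex_differences[OF B(2) A(2)] by simp
  moreover have "0 \<notin> C" using disj unfolding C_def by auto
  ultimately obtain f :: "'a \<Rightarrow> real" where f: "linear f" "continuous_map T euclideanreal f" "\<And>c. c \<in> C \<Longrightarrow> 1 \<le> f c"
    using lcs_separate_closed[OF T] by metis
  have "f a + 1 \<le> f b" if "a \<in> A" "b \<in> B" for a b
    using f(3)[of "b - a"] that linear_diff[OF f(1), of b a] unfolding C_def by force
  then show ?thesis using f that by blast
qed

subsection \<open>Affine functions on compact convex sets\<close>

lemma aff_on_add: "aff_on K f \<Longrightarrow> aff_on K g \<Longrightarrow> aff_on K (\<lambda>x. f x + g x)"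
  unfolding aff_on_def by (simp add: scaleR_add_right)

lemma aff_on_scaleR: "aff_on K f \<Longrightarrow> aff_on K (\<lambda>x. c *\<^sub>R f x)"
  unfolding aff_on_def by (simp add: scaleR_add_right mult.commute)

lemma aff_on_linear: "linear f \<Longrightarrow> aff_on K f"
  unfolding aff_on_def by (simp add: linear_add linear_cmul)

lemma aff_on_const: "aff_on K (\<lambda>_. c)"
  unfolding aff_on_def by (simp add: scaleR_left_distrib[symmetric])

lemma aff_on_subset: "aff_on K f \<Longrightarrow> F \<subseteq> K \<Longrightarrow> aff_on F f"
  unfolding aff_on_def by blast

lemma restr_in [simp]: "x \<in> F \<Longrightarrow> restr F a x = a x"
  by (simp add: restr_def)

section \<open>The space A(K), its elements extended by zero\<close>

lemma restr_notin [simp]: "x \<notin> F \<Longrightarrow> restr F a x = 0"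
  by (simp add: restr_def)

lemma restr_eq_iff: "restr F a = restr F b \<longleftrightarrow> (\<forall>y\<in>F. a y = b y)"
  unfolding restr_def by metis

lemma restr_AK:
  assumes "convex K" "continuous_map (subtopology T K) euclideanreal f" "aff_on K f"
  shows "restr K f \<in> AK T K"
proof -
  have "continuous_map (subtopology T K) euclideanreal (restr K f)"
    by (rule continuous_map_eq[OF assms(2)]) auto
  moreover have "aff_on K (restr K f)"
    unfolding aff_on_def
  proof (intro ballI)
    fix x y and t :: real assume h: "x \<in> K" "y \<in> K" "t \<in> {0..1}"
    then have "(1 - t) *\<^sub>R x + t *\<^sub>R y \<in> K" using convexD_alt[OF assms(1) h(1,2)] by auto
    then show "restr K f ((1 - t) *\<^sub>R x + t *\<^sub>R y) = (1 - t) *\<^sub>R restr K f x + t *\<^sub>R restr K f y"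
      using h assms(3) unfolding aff_on_def by simp
  qed
  ultimately show ?thesis unfolding AK_def by auto
qed

lemma AK_cont: "a \<in> AK T K \<Longrightarrow> continuous_map (subtopology T K) euclideanreal a"
  and AK_aff: "a \<in> AK T K \<Longrightarrow> aff_on K a"
  and AK_outside: "a \<in> AK T K \<Longrightarrow> x \<notin> K \<Longrightarrow> a x = 0"
  by (auto simp: AK_def)

lemma AK_add: "a \<in> AK T K \<Longrightarrow> b \<in> AK T K \<Longrightarrow> (\<lambda>x. a x + b x) \<in> AK T K"
  by (auto simp: AK_def aff_on_add intro!: continuous_map_add)

lemma AK_scale: "a \<in> AK T K \<Longrightarrow> (\<lambda>x. c * a x) \<in> AK T K"
  using aff_on_scaleR[of K a c] by (auto simp: AK_def intro!: continuous_map_real_mult)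

lemma AK_diff: "a \<in> AK T K \<Longrightarrow> b \<in> AK T K \<Longrightarrow> (\<lambda>x. a x - b x) \<in> AK T K"
  using AK_add[of a T K "\<lambda>x. -1 * b x"] AK_scale[of b T K "-1"] by simp

lemma AK_const: "convex K \<Longrightarrow> restr K (\<lambda>_. c) \<in> AK T K"
  by (intro restr_AK aff_on_const) auto

lemma AK_sum:
  assumes "convex K" "finite I" "\<And>i. i \<in> I \<Longrightarrow> a i \<in> AK T K"
  shows "(\<lambda>x. \<Sum>i\<in>I. a i x) \<in> AK T K"
  using assms(2,3)
proof (induction I)
  case empty
  have "restr K (\<lambda>_. 0) = (\<lambda>x. 0)" by (auto simp: restr_def)
  then show ?case using AK_const[OF assms(1), of 0] by simp
qed (simp add: AK_add)

locale split_face_space =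
  fixes T :: "'a::real_vector topology" and K F :: "'a set"
  assumes lcs: "locally_convex_space T" and compact_K: "compactin T K" and convex_K: "convex K"
    and split: "split_face K F" and closed_F: "closedin T F" and F_nonempty: "F \<noteq> {}"
begin

lemma F_subset: "F \<subseteq> K"
  and convex_F: "convex F"
  and face_F: "face K F"
  using split unfolding split_face_def face_def by auto

lemma compact_F: "compactin T F"
  using closed_compactin[OF compact_K F_subset closed_F] .

lemma AK_linear:
  fixes f :: "'a \<Rightarrow> real"
  assumes "linear f" "continuous_map T euclideanreal f"
  shows "restr K f \<in> AK T K"
  using assms by (intro restr_AK convex_K continuous_map_from_subtopology aff_on_linear)

text \<open>Disjoint singletons are compact and convex, so a continuous linear functional separates
  them. Equalities between points of \<open>K\<close> can then be tested on A(K).\<close>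

lemma AK_separates:
  assumes "x \<in> K" "y \<in> K" and eq: "\<And>a. a \<in> AK T K \<Longrightarrow> a x = a y"
  shows "x = y"
proof (rule ccontr)
  assume "x \<noteq> y"
  then have "{x} \<inter> {y} = {}" by simp
  moreover have "compactin T {x}" "compactin T {y}" using lcs_topspace[OF lcs] by auto
  ultimately obtain f :: "'a \<Rightarrow> real" where f: "linear f" "continuous_map T euclideanreal f" "f x + 1 \<le> f y"
    using lcs_separate_compact[OF lcs, of "{x}" "{y}"] by (metis convex_singleton singletonI)
  then show False using eq[OF AK_linear[OF f(1,2)]] assms by simp
qed

lemma AK_bounded:
  assumes "a \<in> AK T K"
  obtains M where "\<And>x. x \<in> K \<Longrightarrow> \<bar>a x\<bar> \<le> M"
proof -
  have "compactin (subtopology T K) K" using compact_K by (simp add: compactin_subtopology)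
  then have "compactin euclideanreal (a ` K)" by (rule image_compactin[OF _ AK_cont[OF assms]])
  then have "bounded (a ` K)" using compact_imp_bounded by auto
  then show ?thesis using that unfolding bounded_iff by auto
qed

lemma le_supK:
  assumes "a \<in> AK T K" "x \<in> K" shows "\<bar>a x\<bar> \<le> supK K a"
proof -
  obtain M where "\<And>x. x \<in> K \<Longrightarrow> \<bar>a x\<bar> \<le> M" using AK_bounded[OF assms(1)] by blast
  then show ?thesis unfolding supK_def
    by (intro cSup_upper) (use assms in \<open>auto intro!: bdd_aboveI[of _ M]\<close>)
qed

lemma supK_le:
  assumes "\<And>x. x \<in> K \<Longrightarrow> \<bar>a x\<bar> \<le> M" shows "supK K a \<le> M"
  unfolding supK_def by (rule cSup_least) (use assms F_nonempty F_subset in auto)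

subsection \<open>Split decompositions and norm-preserving extension\<close>

text \<open>If \<open>t = 1\<close> then \<open>z\<close> is unconstrained; if \<open>t = 0\<close> then \<open>y\<close> is an arbitrary point of \<open>F\<close>.\<close>

definition dec :: "'a \<Rightarrow> real \<Rightarrow> 'a \<Rightarrow> bool" where
  "dec k t y \<longleftrightarrow> 0 \<le> t \<and> t \<le> 1 \<and> y \<in> F \<and>
     (\<exists>z. (t < 1 \<longrightarrow> z \<in> compl_face K F) \<and> k = t *\<^sub>R y + (1 - t) *\<^sub>R z)"

lemma face_F_right:
  assumes "y \<in> K" "z \<in> K" "0 < t" "t < 1" "t *\<^sub>R y + (1 - t) *\<^sub>R z \<in> F" shows "z \<in> F"
  using assms face_F unfolding face_def by blast

lemma compl_face_disjoint: "z \<in> compl_face K F \<Longrightarrow> z \<notin> F"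
  and compl_face_subset: "z \<in> compl_face K F \<Longrightarrow> z \<in> K"
  unfolding compl_face_def face_def by blast+

lemma dec_exists:
  assumes "k \<in> K" obtains t y where "dec k t y"
proof -
  consider "k \<in> F" | "k \<in> compl_face K F" | "k \<in> K - (F \<union> compl_face K F)" using assms by blast
  then show ?thesis
  proof cases
    case 1
    then have "dec k 1 k" by (simp add: dec_def)
    then show ?thesis using that by blast
  next
    case 2
    obtain p where "p \<in> F" using F_nonempty by blast
    then have "dec k 0 p" using 2 by (simp add: dec_def)
    then show ?thesis using that by blast
  next
    case 3
    then have "\<exists>!p. case p of (t, y, z) \<Rightarrow> 0 < t \<and> t < (1::real) \<and> y \<in> F \<and> z \<in> compl_face K F \<and>
               k = t *\<^sub>R y + (1 - t) *\<^sub>R z"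
      using split unfolding split_face_def by blast
    then obtain p where p: "case p of (t, y, z) \<Rightarrow> 0 < t \<and> t < (1::real) \<and> y \<in> F \<and> z \<in> compl_face K F \<and>
               k = t *\<^sub>R y + (1 - t) *\<^sub>R z"
      by (rule ex1E)
    obtain t y z where "p = (t, y, z)" by (cases p)
    then have "0 < t" "t < (1::real)" "y \<in> F" "z \<in> compl_face K F"
      "k = t *\<^sub>R y + (1 - t) *\<^sub>R z"
      using p by simp_all
    then have "dec k t y" by (auto simp: dec_def)
    then show ?thesis using that by blast
  qed
qed

text \<open>If the weight of \<open>z\<close> were positive, the face property (or
  \<open>k = z\<close> when \<open>t = 0\<close>) would place \<open>z\<close> in \<open>F\<close>,
  while the complementary face is disjoint from \<open>F\<close>.\<close>

lemma dec_in_F: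
  assumes "dec k t y" "k \<in> F" shows "t = 1" "y = k"
proof -
  obtain z where z: "t < 1 \<longrightarrow> z \<in> compl_face K F" "k = t *\<^sub>R y + (1 - t) *\<^sub>R z" and t: "0 \<le> t" "t \<le> 1" "y \<in> F"
    using assms unfolding dec_def by blast
  show "t = 1"
  proof (rule ccontr)
    assume "t \<noteq> 1"
    then have zc: "z \<in> compl_face K F" "t < 1" using z t by auto
    show False
    proof (cases "t = 0")
      case True
      then show False using z zc assms compl_face_disjoint by auto
    next
      case False
      then have "z \<in> F" using zc z t assms(2) compl_face_subset[OF zc(1)] F_subset
        by (intro face_F_right[of y z t]) auto
      then show False using compl_face_disjoint zc by blast
    qed
  qed
  then show "y = k" using z by simp
qed

text \<open>The point \<open>k\<close> lies in some face \<open>G\<close> disjoint from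
  \<open>F\<close>; a positive weight on \<open>y\<close> would force \<open>y\<close> into
  \<open>G\<close>.\<close>

lemma dec_in_compl_face:
  assumes "dec k t y" "k \<in> compl_face K F" shows "t = 0"
proof (rule ccontr)
  assume "t \<noteq> 0"
  obtain z where z: "t < 1 \<longrightarrow> z \<in> compl_face K F" "k = t *\<^sub>R y + (1 - t) *\<^sub>R z" and t: "0 \<le> t" "t \<le> 1" "y \<in> F"
    using assms unfolding dec_def by blast
  show False
  proof (cases "t = 1")
    case True
    then show False using z t assms compl_face_disjoint by auto
  next
    case False
    obtain G where G: "face K G" "G \<inter> F = {}" "k \<in> G" using assms unfolding compl_face_def by blast
    have "z \<in> K" "y \<in> K" using z False t F_subset compl_face_subset by auto
    moreover have "0 < t" "t < 1" using t False \<open>t \<noteq> 0\<close> by auto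
    ultimately have "y \<in> G" using G(1,3) unfolding z(2) face_def by blast
    then show False using G t by blast
  qed
qed

text \<open>When \<open>t = 0\<close> the point \<open>y\<close> is arbitrary, so only the product
  \<open>t * a y\<close> can be determined. This is the quantity in which heights are compared
  later.\<close>

lemma dec_unique:
  assumes "k \<in> K" and d: "dec k t y" "dec k s w"
  shows "t = s" "t * a y = s * a w"
proof -
  have "t = s \<and> (t = 0 \<or> y = w)"
  proof -
    consider "k \<in> F" | "k \<in> compl_face K F" | "k \<in> K - (F \<union> compl_face K F)" using assms by blast
    then show ?thesis
    proof cases
      case 1
      then show ?thesis using dec_in_F d by metis
    next
      case 2
      then show ?thesis using dec_in_compl_face d by metis
    next
      case 3
      have pt: "\<exists>z. 0 < t \<and> t < 1 \<and> y \<in> F \<and> z \<in> compl_face K F \<and> k = t *\<^sub>R y + (1 - t) *\<^sub>R z"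
        if "dec k t y" for t y
      proof -
        obtain z where z: "t < 1 \<longrightarrow> z \<in> compl_face K F" "k = t *\<^sub>R y + (1 - t) *\<^sub>R z" and t: "0 \<le> t" "t \<le> 1" "y \<in> F"
          using \<open>dec k t y\<close> unfolding dec_def by blast
        have "t \<noteq> 1" using z(2) t(3) 3 by auto
        moreover have "t \<noteq> 0" using z 3 by auto
        ultimately have "0 < t" "t < 1" using t by auto
        then show ?thesis using z t by blast
      qed
      obtain z1 where z1: "0 < t" "t < 1" "y \<in> F" "z1 \<in> compl_face K F" "k = t *\<^sub>R y + (1 - t) *\<^sub>R z1"
        using pt[OF d(1)] by blast
      obtain z2 where z2: "0 < s" "s < 1" "w \<in> F" "z2 \<in> compl_face K F" "k = s *\<^sub>R w + (1 - s) *\<^sub>R z2"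
        using pt[OF d(2)] by blast
      let ?P = "\<lambda>p. case p of (t, y, z) \<Rightarrow> 0 < t \<and> t < (1::real) \<and> y \<in> F \<and> z \<in> compl_face K F \<and>
               k = t *\<^sub>R y + (1 - t) *\<^sub>R z"
      have "\<exists>!p. ?P p" using split 3 unfolding split_face_def by blast
      moreover have "?P (t, y, z1)" "?P (s, w, z2)" using z1 z2 by auto
      ultimately have "(t, y, z1) = (s, w, z2)" by blast
      then show ?thesis by simp
    qed
  qed
  then show "t = s" "t * a y = s * a w" by auto
qed

text \<open>The left side of the inequality is the height of a point of the join of
  \<open>K \<times> {-1}\<close> with the graph of \<open>a\<close>. Decomposing \<open>k'\<close>
  and merging its part in \<open>F\<close> with \<open>y\<close> gives the total weight
  \<open>t = l * t' + (1 - l)\<close> and leaves \<open>z\<close> unchanged; the bound then comes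
  from \<open>a y' \<ge> -1\<close>.\<close>

lemma dec_join:
  assumes k': "k' \<in> K" and y: "y \<in> F" and l: "0 \<le> l" "l \<le> 1"
    and a: "aff_on F a" "\<And>y. y \<in> F \<Longrightarrow> \<bar>a y\<bar> \<le> 1"
  obtains t w where "dec (l *\<^sub>R k' + (1 - l) *\<^sub>R y) t w" "- l + (1 - l) * a y \<le> t * a w - (1 - t)"
proof -
  obtain t' y' where "dec k' t' y'" using dec_exists[OF k'] .
  then obtain z where z: "t' < 1 \<longrightarrow> z \<in> compl_face K F" "k' = t' *\<^sub>R y' + (1 - t') *\<^sub>R z"
    and t': "0 \<le> t'" "t' \<le> 1" "y' \<in> F" unfolding dec_def by blast
  define t where "t = l * t' + (1 - l)"
  have l': "0 \<le> 1 - l" using l by simp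
  have lt: "0 \<le> l * t'" "l * t' \<le> l * 1" using l t' mult_left_mono[of t' 1 l] by auto
  obtain w where w: "w \<in> F" "(l * t') *\<^sub>R y' + (1 - l) *\<^sub>R y = t *\<^sub>R w"
    and "\<And>f :: 'a \<Rightarrow> real. aff_on F f \<Longrightarrow> (l * t') * f y' + (1 - l) * f y = t * f w"
    using convex_cone_comb[OF convex_F t'(3) y lt(1) l'] unfolding t_def by blast
  then have wa: "(l * t') * a y' + (1 - l) * a y = t * a w" using a(1) by blast
  have "l *\<^sub>R k' + (1 - l) *\<^sub>R y = ((l * t') *\<^sub>R y' + (1 - l) *\<^sub>R y) + (1 - t) *\<^sub>R z"
    unfolding z(2) t_def by (simp add: algebra_simps)
  then have eq: "l *\<^sub>R k' + (1 - l) *\<^sub>R y = t *\<^sub>R w + (1 - t) *\<^sub>R z" unfolding w(2) .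
  have "t < 1 \<longrightarrow> t' < 1" using t' unfolding t_def by (cases "t' = 1") auto
  then have "dec (l *\<^sub>R k' + (1 - l) *\<^sub>R y) t w"
    unfolding dec_def eq using z(1) w(1) lt l by (auto simp: t_def)
  moreover have "(l * t') * - a y' \<le> (l * t') * 1"
    using a(2)[OF t'(3)] lt(1) by (intro mult_left_mono) auto
  then have "- l + (1 - l) * a y \<le> t * a w - (1 - t)"
    using wa by (simp add: t_def)
  ultimately show ?thesis using that by blast
qed

text \<open>A hyperplane separating the two joins is the graph of an affine function
  \<open>b\<close>. Passing between \<open>K \<times> {-1}\<close> and
  \<open>K \<times> {1 + e}\<close> bounds \<open>b\<close> on \<open>K\<close>; passing between the
  graphs of \<open>a\<close> and \<open>a + e\<close> gives \<open>a \<le> b \<le> a + e\<close> on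
  \<open>F\<close>.\<close>

lemma AK_approx_extension:
  assumes a: "a \<in> AK T K" "\<And>y. y \<in> F \<Longrightarrow> \<bar>a y\<bar> \<le> 1" and e: "0 < e"
  obtains b where "b \<in> AK T K" "\<And>k. k \<in> K \<Longrightarrow> \<bar>b k\<bar> \<le> 1 + e" "\<And>y. y \<in> F \<Longrightarrow> \<bar>b y - a y\<bar> \<le> e"
proof -
  let ?TR = "prod_topology T euclideanreal"
  define A where "A c d = join (K \<times> {c :: real}) ((\<lambda>y. (y, a y + d)) ` F)" for c d
  note TR = lcs_prod_real[OF lcs]
  have affF: "aff_on F a" using AK_aff[OF a(1)] F_subset by (rule aff_on_subset)
  have conv: "convex (A c d)" for c d
    unfolding A_def
  proof (intro convex_join convex_Times convex_K convex_singleton)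
    show "convex ((\<lambda>y. (y, a y + d)) ` F)"
      unfolding convex_alt
    proof (intro ballI allI impI)
      fix p q and u :: real assume "p \<in> (\<lambda>y. (y, a y + d)) ` F" "q \<in> (\<lambda>y. (y, a y + d)) ` F" and u: "0 \<le> u \<and> u \<le> 1"
      then obtain y z where yz: "p = (y, a y + d)" "q = (z, a z + d)" "y \<in> F" "z \<in> F" by blast
      have "(1 - u) *\<^sub>R y + u *\<^sub>R z \<in> F" using convexD_alt[OF convex_F yz(3,4)] u by blast
      moreover have "a ((1 - u) *\<^sub>R y + u *\<^sub>R z) = (1 - u) * a y + u * a z"
        using affF yz u unfolding aff_on_def by simp
      ultimately show "(1 - u) *\<^sub>R p + u *\<^sub>R q \<in> (\<lambda>y. (y, a y + d)) ` F"
        unfolding yz(1,2) by (intro image_eqI[of _ _ "(1 - u) *\<^sub>R y + u *\<^sub>R z"]) (auto simp: algebra_simps)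
    qed
  qed
  have comp: "compactin ?TR (A c d)" for c d
    unfolding A_def
  proof (intro compactin_join[OF TR])
    show "compactin ?TR (K \<times> {c})" using compact_K by (simp add: compactin_Times)
    have c1: "continuous_map (subtopology T F) T (\<lambda>y. y)"
      using continuous_map_id_subt[of T F] by (simp add: id_def)
    have "continuous_map (subtopology T F) ?TR (\<lambda>y. (y, a y + d))"
      by (intro continuous_map_pairedI continuous_map_add c1
          continuous_map_from_subtopology_mono[OF AK_cont[OF a(1)] F_subset]) auto
    then show "compactin ?TR ((\<lambda>y. (y, a y + d)) ` F)"
      using compact_F by (intro image_compactin[of "subtopology T F"]) (auto simp: compactin_subtopology)
  qed
  \<comment> \<open>At a common base point, \<open>dec_join\<close> for \<open>a\<close> bounds the
    lower height by \<open>t * a w - (1 - t)\<close>, and \<open>dec_join\<close> for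
    \<open>- a\<close> bounds the upper height from below by
    \<open>t' * a w' + (1 - t') + e\<close>. By \<open>dec_unique\<close> the two products agree, so
    the heights differ by at least \<open>e\<close>.\<close>
  have disj: "A (-1) 0 \<inter> A (1 + e) e = {}"
  proof (rule ccontr)
    assume "A (-1) 0 \<inter> A (1 + e) e \<noteq> {}"
    then obtain p where p: "p \<in> A (-1) 0" "p \<in> A (1 + e) e" by blast
    obtain l k y where 1: "0 \<le> l" "l \<le> 1" "k \<in> K" "y \<in> F" "p = (l *\<^sub>R k + (1 - l) *\<^sub>R y, - l + (1 - l) * a y)"
      using p(1) unfolding A_def join_def by force
    obtain l' k' y' where 2: "0 \<le> l'" "l' \<le> 1" "k' \<in> K" "y' \<in> F"
        "p = (l' *\<^sub>R k' + (1 - l') *\<^sub>R y', l' * (1 + e) + (1 - l') * (a y' + e))"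
      using p(2) unfolding A_def join_def by force
    obtain t w where d1: "dec (l *\<^sub>R k + (1 - l) *\<^sub>R y) t w" "- l + (1 - l) * a y \<le> t * a w - (1 - t)"
      using dec_join[OF 1(3,4,1,2) affF a(2)] by blast
    have "aff_on F (\<lambda>y. - a y)" using aff_on_scaleR[OF affF, of "-1"] by simp
    then obtain t' w' where d2: "dec (l' *\<^sub>R k' + (1 - l') *\<^sub>R y') t' w'" "- l' + (1 - l') * - a y' \<le> t' * - a w' - (1 - t')"
      using dec_join[OF 2(3,4,1,2), of "\<lambda>y. - a y"] a(2) by auto
    have eq: "l *\<^sub>R k + (1 - l) *\<^sub>R y = l' *\<^sub>R k' + (1 - l') *\<^sub>R y'" 
      and v: "- l + (1 - l) * a y = l' * (1 + e) + (1 - l') * (a y' + e)" using 1(5) 2(5) by auto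
    have "l *\<^sub>R k + (1 - l) *\<^sub>R y \<in> K"
      using convexD_alt[OF convex_K, of y k l] 1 F_subset by (auto simp: add.commute)
    from dec_unique(1)[OF this d1(1) d2(1)[folded eq]] dec_unique(2)[OF this d1(1) d2(1)[folded eq], of a]
    have u: "t = t'" "t * a w = t' * a w'" by auto
    have "t \<le> 1" using d1 by (simp add: dec_def)
    then have "- l + (1 - l) * a y \<le> l' + (1 - l') * a y'"
      using u d1(2) d2(2) by (simp only: mult_minus_right)
    moreover have "l' * (1 + e) + (1 - l') * (a y' + e) = l' + (1 - l') * a y' + e" by (simp add: algebra_simps)
    ultimately show False using v e by linarith
  qed
  obtain f where f: "linear f" "continuous_map ?TR euclideanreal f"
    and sep: "\<And>p q. p \<in> A (-1) 0 \<Longrightarrow> q \<in> A (1 + e) e \<Longrightarrow> f p + 1 \<le> f q"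
    using lcs_separate_compact[OF TR comp conv comp conv disj] by blast
  define h where "h x = f (x, 0)" for x
  define c where "c = f (0, 1)"
  have fhc: "f (x, s) = h x + c * s" for x s
  proof -
    have "(x, s) = (x, 0) + s *\<^sub>R (0, 1)" by simp
    then show ?thesis unfolding h_def c_def by (metis linear_add[OF f(1)] linear_cmul[OF f(1)] real_scaleR_def mult.commute)
  qed
  obtain y0 where y0: "y0 \<in> F" using F_nonempty by blast
  have inK: "(k, s) \<in> A s d" if "k \<in> K" for k s d
    unfolding A_def join_def using that y0 by (intro image_eqI[of _ _ "(1, (k, s), (y0, a y0 + d))"]) auto
  have inF: "(y, a y + d) \<in> A s d" if "y \<in> F" for y s d
    unfolding A_def join_def using that y0 F_subset by (intro image_eqI[of _ _ "(0, (y0, s), (y, a y + d))"]) auto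
  have y0K: "y0 \<in> K" using y0 F_subset by blast
  \<comment> \<open>The sets contain \<open>(y0, -1)\<close> and \<open>(y0, 1 + e)\<close>, which
    differ only in height. Hence \<open>c\<close> is positive and the hyperplane is not
    vertical.\<close>
  have "c * (2 + e) \<ge> 1" using sep[OF inK[OF y0K] inK[OF y0K]] unfolding fhc by (simp add: algebra_simps)
  then have c: "c > 0" using e by (smt (verit) mult_nonneg_nonpos2 mult.commute)
  define \<alpha> where "\<alpha> = Sup (f ` A (-1) 0)"
  have below: "f p \<le> \<alpha>" if "p \<in> A (-1) 0" for p
    unfolding \<alpha>_def
  proof (rule cSup_upper)
    show "bdd_above (f ` A (-1) 0)"
      by (rule bdd_aboveI2[of _ _ "f (y0, 1 + e)"]) (use sep[OF _ inK[OF y0K]] in fastforce)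
  qed (use that in blast)
  have above: "\<alpha> \<le> f q" if "q \<in> A (1 + e) e" for q
    unfolding \<alpha>_def
  proof (rule cSup_least)
    show "f ` A (-1) 0 \<noteq> {}" using inK[OF y0K] by blast
    show "x \<le> f q" if "x \<in> f ` A (-1) 0" for x using sep[OF _ \<open>q \<in> _\<close>] that by fastforce
  qed
  \<comment> \<open>The value \<open>b x\<close> solves \<open>h x + c * b x = \<alpha>\<close>, so
    the graph of \<open>b\<close> over \<open>K\<close> is the part of the level set of
    \<open>f\<close> lying over \<open>K\<close>.\<close>
  define b where "b = restr K (\<lambda>x. (1 / c) * (\<alpha> + -1 * h x))"
  have hlin: "linear h" 
  proof (rule linearI)
    show "h (x + y) = h x + h y" for x y unfolding h_def using linear_add[OF f(1), of "(x, 0)" "(y, 0)"] by simp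
    show "h (r *\<^sub>R x) = r *\<^sub>R h x" for r x unfolding h_def using linear_cmul[OF f(1), of r "(x, 0)"] by simp
  qed
  have "continuous_map T euclideanreal (f \<circ> (\<lambda>x. (x, 0)))"
    using continuous_map_id[of T] by (intro continuous_map_compose[OF _ f(2)] continuous_map_pairedI) (auto simp: id_def)
  then have hcont: "continuous_map T euclideanreal h" unfolding h_def o_def .
  have "b \<in> AK T K"
    unfolding b_def
  proof (rule restr_AK[OF convex_K])
    show "continuous_map (subtopology T K) euclideanreal (\<lambda>x. (1 / c) * (\<alpha> + -1 * h x))"
      by (intro continuous_map_real_mult continuous_map_add continuous_map_from_subtopology hcont) auto
    show "aff_on K (\<lambda>x. (1 / c) * (\<alpha> + -1 * h x))"
      using aff_on_scaleR[OF aff_on_add[OF aff_on_const[of K \<alpha>] aff_on_scaleR[OF aff_on_linear[OF hlin, of K], of "-1"]], of "1/c"]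
      by simp
  qed
  moreover have "b k \<ge> s" if "(k, s) \<in> A (-1) 0" "k \<in> K" for k s
    using below[OF that(1)] that(2) c unfolding b_def fhc by (simp add: field_simps)
  moreover have "b k \<le> s" if "(k, s) \<in> A (1 + e) e" "k \<in> K" for k s
    using above[OF that(1)] that(2) c unfolding b_def fhc by (simp add: field_simps)
  ultimately show ?thesis
    using that[of b] inK[of _ "-1" 0] inK[of _ "1 + e" e] inF[of _ 0 "-1"] inF[of _ e "1 + e"] F_subset e by (smt (verit) subsetD)
qed

lemma AK_approx_extension_scaled:
  assumes a: "a \<in> AK T K" "\<And>y. y \<in> F \<Longrightarrow> \<bar>a y\<bar> \<le> r" and e: "0 < e" and r: "0 < r"
  obtains b where "b \<in> AK T K" "\<And>k. k \<in> K \<Longrightarrow> \<bar>b k\<bar> \<le> r * (1 + e)" "\<And>y. y \<in> F \<Longrightarrow> \<bar>a y - b y\<bar> \<le> r * e"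
proof -
  have "\<bar>(1 / r) * a y\<bar> \<le> 1" if "y \<in> F" for y using a(2)[OF that] r by (simp add: abs_mult)
  then obtain b where b: "b \<in> AK T K" "\<And>k. k \<in> K \<Longrightarrow> \<bar>b k\<bar> \<le> 1 + e"
    "\<And>y. y \<in> F \<Longrightarrow> \<bar>b y - (1 / r) * a y\<bar> \<le> e"
    using AK_approx_extension[OF AK_scale[OF a(1), of "1 / r"] _ e] by blast
  show ?thesis
  proof (rule that[of "\<lambda>x. r * b x"])
    show "\<bar>r * b k\<bar> \<le> r * (1 + e)" if "k \<in> K" for k using b(2)[OF that] r by (simp add: abs_mult)
    show "\<bar>a y - r * b y\<bar> \<le> r * e" if "y \<in> F" for y
    proof -
      have "a y - r * b y = - r * (b y - (1 / r) * a y)" using r by (simp add: algebra_simps)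
      then show ?thesis using b(3)[OF that] r by (simp add: abs_mult)
    qed
  qed (rule AK_scale[OF b(1)])
qed

lemma AK_uniform_limit:
  assumes a: "\<And>n. a n \<in> AK T K" and lim: "uniform_limit K a b sequentially" and out: "\<And>x. x \<notin> K \<Longrightarrow> b x = 0"
  shows "b \<in> AK T K"
proof -
  have "continuous_map (subtopology T K) Met_TC.mtopology b"
  proof (rule Met_TC.continuous_map_uniform_limit)
    show "\<forall>\<^sub>F n in sequentially. continuous_map (subtopology T K) Met_TC.mtopology (a n)"
      using AK_cont[OF a] by simp
    show "\<forall>\<^sub>F n in sequentially. \<forall>x\<in>topspace (subtopology T K). b x \<in> UNIV \<and> dist (a n x) (b x) < e" if "0 < e" for e
      using uniform_limitD[OF lim that] by (rule eventually_mono) auto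
  qed auto
  moreover have "aff_on K b"
    unfolding aff_on_def
  proof (intro ballI)
    fix x y and t :: real assume h: "x \<in> K" "y \<in> K" "t \<in> {0..1}"
    have p: "(\<lambda>n. a n k) \<longlonglongrightarrow> b k" if "k \<in> K" for k using tendsto_uniform_limitI[OF lim that] .
    have "(1 - t) *\<^sub>R x + t *\<^sub>R y \<in> K" using convexD_alt[OF convex_K h(1,2)] h by auto
    then have "(\<lambda>n. a n ((1 - t) *\<^sub>R x + t *\<^sub>R y)) \<longlonglongrightarrow> b ((1 - t) *\<^sub>R x + t *\<^sub>R y)" by (rule p)
    moreover have "a n ((1 - t) *\<^sub>R x + t *\<^sub>R y) = (1 - t) *\<^sub>R a n x + t *\<^sub>R a n y" for n
      using AK_aff[OF a] h unfolding aff_on_def by blast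
    moreover have "(\<lambda>n. (1 - t) *\<^sub>R a n x + t *\<^sub>R a n y) \<longlonglongrightarrow> (1 - t) *\<^sub>R b x + t *\<^sub>R b y"
      by (intro tendsto_intros p h)
    ultimately show "b ((1 - t) *\<^sub>R x + t *\<^sub>R y) = (1 - t) *\<^sub>R b x + t *\<^sub>R b y"
      using LIMSEQ_unique by simp
  qed
  ultimately show ?thesis using out by (simp add: AK_def)
qed

text \<open>The remainder \<open>g n\<close> has size at most \<open>r * e ^ n\<close> on
  \<open>F\<close>, and each correction \<open>g n - g (Suc n)\<close> is controlled on all of
  \<open>K\<close>. The corrections telescope to \<open>a\<close> on \<open>F\<close>, and their
  bounds form a geometric series with sum \<open>s\<close>.\<close>

proposition AK_extension:
  assumes a: "a \<in> AK T K" "\<And>y. y \<in> F \<Longrightarrow> \<bar>a y\<bar> \<le> r" and r: "0 < r" "r < s"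
  obtains b where "b \<in> AK T K" "\<And>y. y \<in> F \<Longrightarrow> b y = a y" "\<And>k. k \<in> K \<Longrightarrow> \<bar>b k\<bar> \<le> s"
proof -
  \<comment> \<open>This is the solution of \<open>r * (1 + e) / (1 - e) = s\<close>.\<close>
  define e where "e = (s - r) / (s + r)"
  have e: "0 < e" "e < 1" using r unfolding e_def by (auto simp: field_simps)
  have "1 + e = 2 * s / (s + r)" "1 - e = 2 * r / (s + r)" using r unfolding e_def by (auto simp: field_simps)
  then have es: "r * (1 + e) / (1 - e) = s" using r by simp
  define P where "P n x \<longleftrightarrow> x \<in> AK T K \<and> (\<forall>y\<in>F. \<bar>x y\<bar> \<le> r * e ^ n)" for n and x :: "'a \<Rightarrow> real"
  define Q where "Q n x x' \<longleftrightarrow> (\<forall>k\<in>K. \<bar>x k - x' k\<bar> \<le> r * (1 + e) * e ^ n)" for n and x x' :: "'a \<Rightarrow> real"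
  have "\<exists>g. g 0 = a \<and> (\<forall>n. P n (g n) \<and> Q n (g n) (g (Suc n)))"
  proof -
    have "\<exists>y. P (Suc n) y \<and> Q n x y" if "P n x" for n x
    proof -
      have "0 < r * e ^ n" using r e by simp
      moreover have "x \<in> AK T K" "\<And>y. y \<in> F \<Longrightarrow> \<bar>x y\<bar> \<le> r * e ^ n" using that by (auto simp: P_def)
      ultimately obtain b where b: "b \<in> AK T K" "\<And>k. k \<in> K \<Longrightarrow> \<bar>b k\<bar> \<le> r * e ^ n * (1 + e)"
        "\<And>y. y \<in> F \<Longrightarrow> \<bar>x y - b y\<bar> \<le> r * e ^ n * e"
        using AK_approx_extension_scaled[of x "r * e ^ n" e] e(1) by blast
      have "P (Suc n) (\<lambda>y. x y - b y)" unfolding P_def using that b AK_diff by (auto simp: P_def ac_simps)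
      moreover have "Q n x (\<lambda>y. x y - b y)" unfolding Q_def using b(2) by (simp add: ac_simps)
      ultimately show ?thesis by blast
    qed
    moreover have "P 0 a" using a by (simp add: P_def)
    \<comment> \<open>The added clause for \<open>n = 0\<close> pins the start of the chosen
      sequence to \<open>a\<close>.\<close>
    ultimately show ?thesis using dependent_nat_choice[of "\<lambda>n x. P n x \<and> (n = 0 \<longrightarrow> x = a)" Q] by (metis nat.distinct(1))
  qed
  then obtain g where g0: "g 0 = a" and P: "\<And>n. P n (g n)" and Q: "\<And>n. Q n (g n) (g (Suc n))" by blast
  define b where "b x = (\<Sum>n. g n x - g (Suc n) x)" for x
  have geo: "(\<lambda>n. r * (1 + e) * e ^ n) sums s"
    using sums_mult[OF geometric_sums[of e], of "r * (1 + e)"] e es by simp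
  have bound: "norm (g n x - g (Suc n) x) \<le> r * (1 + e) * e ^ n" if "x \<in> K" for n x
    using Q[of n] that unfolding Q_def by simp
  show ?thesis
  proof (rule that)
    have unif: "uniform_limit K (\<lambda>n x. \<Sum>i<n. g i x - g (Suc i) x) b sequentially"
      unfolding b_def by (rule Weierstrass_m_test[OF bound sums_summable[OF geo]])
    have mem: "(\<lambda>x. \<Sum>i<n. g i x - g (Suc i) x) \<in> AK T K" for n
      using P by (intro AK_sum convex_K AK_diff) (auto simp: P_def)
    have out: "b x = 0" if "x \<notin> K" for x
      unfolding b_def using AK_outside[of "g _" T K x] that P unfolding P_def by simp
    show "b \<in> AK T K" by (rule AK_uniform_limit[OF mem unif out])
    show "b y = a y" if "y \<in> F" for y
    proof -
      have "(\<lambda>n. r * e ^ n) \<longlonglongrightarrow> r * 0" using e by (intro tendsto_intros LIMSEQ_power_zero) auto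
      then have "(\<lambda>n. g n y) \<longlonglongrightarrow> 0"
        by (intro Lim_null_comparison[of "\<lambda>n. g n y" "\<lambda>n. r * e ^ n"]) (use P that in \<open>auto simp: P_def\<close>)
      then have "(\<lambda>n. g n y - g (Suc n) y) sums (g 0 y - 0)" by (rule telescope_sums')
      then show ?thesis unfolding b_def using sums_unique g0 by fastforce
    qed
    show "\<bar>b k\<bar> \<le> s" if "k \<in> K" for k
    proof -
      have "norm (b k) \<le> (\<Sum>n. r * (1 + e) * e ^ n)"
        unfolding b_def by (rule norm_suminf_le[OF _ sums_summable[OF geo]]) (use bound that in auto)
      then show ?thesis using sums_unique[OF geo] by simp
    qed
  qed
qed

subsection \<open>The quotient as an order unit space\<close>

lemma supK_nonneg: "a \<in> AK T K \<Longrightarrow> 0 \<le> supK K a"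
  using le_supK F_nonempty F_subset by (meson abs_ge_zero all_not_in_conv order_trans subsetD)

lemma qnorm_le_supK:
  assumes "a \<in> AK T K" shows "qnorm T K F (restr F a) \<le> supK K a"
  unfolding qnorm_def
  by (rule cInf_lower) (use assms supK_nonneg in \<open>auto intro!: bdd_belowI[of _ 0]\<close>)

lemma abs_le_qnorm:
  assumes "x \<in> quot T K F" "p \<in> F" shows "\<bar>x p\<bar> \<le> qnorm T K F x"
  unfolding qnorm_def
proof (rule cInf_greatest)
  show "{supK K a |a. a \<in> AK T K \<and> restr F a = x} \<noteq> {}" using assms unfolding quot_def by blast
  fix c assume "c \<in> {supK K a |a. a \<in> AK T K \<and> restr F a = x}"
  then obtain a where "c = supK K a" "a \<in> AK T K" "restr F a = x" by blast
  then show "\<bar>x p\<bar> \<le> c" using le_supK[of a p] assms F_subset by auto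
qed

text \<open>For every \<open>s > r\<close> the extension result supplies a representative of norm at
  most \<open>s\<close>. Together with \<open>abs_le_qnorm\<close> this identifies the quotient norm
  with the supremum norm on \<open>F\<close>.\<close>

lemma qnorm_le:
  assumes x: "x \<in> quot T K F" "\<And>p. p \<in> F \<Longrightarrow> \<bar>x p\<bar> \<le> r" and r: "0 < r"
  shows "qnorm T K F x \<le> r"
proof (rule dense_ge)
  fix s assume s: "r < s"
  obtain a where a: "a \<in> AK T K" "x = restr F a" using x unfolding quot_def by blast
  then have "\<bar>a y\<bar> \<le> r" if "y \<in> F" for y using x(2)[OF that] that by simp
  then obtain b where b: "b \<in> AK T K" "\<And>y. y \<in> F \<Longrightarrow> b y = a y" "\<And>k. k \<in> K \<Longrightarrow> \<bar>b k\<bar> \<le> s"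
    using AK_extension[OF a(1) _ r s] by blast
  have "x = restr F b" unfolding a(2) restr_eq_iff using b(2) by simp
  then show "qnorm T K F x \<le> s" using qnorm_le_supK[OF b(1)] supK_le[of b s] b(3) by simp
qed

text \<open>The carrier consists of functions on the ambient space, so this is an admissible
  \<open>E\<close> in \<open>pos_lifting\<close>. The order compares values on \<open>F\<close>
  only.\<close>

definition quot_ous :: "('a \<Rightarrow> real) ous" where
  "quot_ous = \<lparr>oc = quot T K F, oadd = (\<lambda>x y p. x p + y p), osmul = (\<lambda>c x p. c * x p),
     ozero = (\<lambda>_. 0), ole = (\<lambda>x y. \<forall>p\<in>F. x p \<le> y p), ounit = restr F (\<lambda>_. 1)\<rparr>"

lemma quot_ous_sel [simp]:
  "oc quot_ous = quot T K F" "oadd quot_ous = (\<lambda>x y p. x p + y p)" "osmul quot_ous = (\<lambda>c x p. c * x p)"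
  "ozero quot_ous = (\<lambda>_. 0)" "ole quot_ous = (\<lambda>x y. \<forall>p\<in>F. x p \<le> y p)"
  "ounit quot_ous = restr F (\<lambda>_. 1)"
  by (simp_all add: quot_ous_def)

lemma restr_quot: "a \<in> AK T K \<Longrightarrow> restr F a \<in> quot T K F"
  by (simp add: quot_def)

lemma restr_restr: "restr F (restr K a) = restr F a"
  unfolding restr_def by (rule ext) (use F_subset in auto)

lemma unit_quot: "restr F (\<lambda>_. c) \<in> quot T K F"
  using restr_quot[OF AK_const[OF convex_K, of c T]] by (simp add: restr_restr)

lemma restr_add: "restr F (\<lambda>p. a p + b p) = (\<lambda>p. restr F a p + restr F b p)"
  and restr_scale: "restr F (\<lambda>p. c * a p) = (\<lambda>p. c * restr F a p)"
  by (auto simp: restr_def)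

lemma quotE:
  assumes "x \<in> quot T K F" obtains a where "a \<in> AK T K" "x = restr F a"
  using assms unfolding quot_def by blast

lemma quot_add:
  assumes "x \<in> quot T K F" "y \<in> quot T K F" shows "(\<lambda>p. x p + y p) \<in> quot T K F"
proof -
  obtain a where a: "a \<in> AK T K" "x = restr F a" using assms(1) by (rule quotE)
  obtain b where b: "b \<in> AK T K" "y = restr F b" using assms(2) by (rule quotE)
  show ?thesis using restr_quot[OF AK_add[OF a(1) b(1)]] unfolding a(2) b(2) restr_add .
qed

lemma quot_scale:
  assumes "x \<in> quot T K F" shows "(\<lambda>p. c * x p) \<in> quot T K F"
proof -
  obtain a where a: "a \<in> AK T K" "x = restr F a" using assms by (rule quotE)
  show ?thesis using restr_quot[OF AK_scale[OF a(1)]] unfolding a(2) restr_scale .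
qed

lemma quot_outside: "x \<in> quot T K F \<Longrightarrow> p \<notin> F \<Longrightarrow> x p = 0"
  unfolding quot_def by auto

lemma quot_bounded:
  assumes "x \<in> quot T K F" obtains r where "0 < r" "\<And>p. p \<in> F \<Longrightarrow> \<bar>x p\<bar> \<le> r"
proof (rule that)
  show "0 < max 1 (qnorm T K F x)" by simp
  show "\<bar>x p\<bar> \<le> max 1 (qnorm T K F x)" if "p \<in> F" for p
    using abs_le_qnorm[OF assms that] by simp
qed

lemma order_unit_space_quot: "order_unit_space quot_ous"
proof -
  have zero: "(\<lambda>_. 0) \<in> quot T K F" using unit_quot[of 0] by (simp add: restr_def)
  \<comment> \<open>Equality on \<open>F\<close> is enough because elements of the quotient vanish
    off \<open>F\<close>.\<close>
  have antisym: "x = y"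
    if "x \<in> quot T K F" "y \<in> quot T K F" "\<forall>p\<in>F. x p \<le> y p" "\<forall>p\<in>F. y p \<le> x p" for x y
  proof
    show "x p = y p" for p using that quot_outside by (cases "p \<in> F") (auto intro: order_antisym simp: quot_outside)
  qed
  have bd: "\<exists>r>0. (\<forall>p\<in>F. - r * restr F (\<lambda>_. 1) p \<le> x p) \<and> (\<forall>p\<in>F. x p \<le> r * restr F (\<lambda>_. 1) p)"
    if x: "x \<in> quot T K F" for x
  proof -
    obtain r where "0 < r" "\<And>p. p \<in> F \<Longrightarrow> \<bar>x p\<bar> \<le> r" using quot_bounded[OF x] by blast
    then show ?thesis by (intro exI[of _ r]) (auto simp: abs_le_iff minus_le_iff)
  qed
  have arch: "\<forall>p\<in>F. x p \<le> 0" if "\<forall>r>0. \<forall>p\<in>F. x p \<le> r * restr F (\<lambda>_. 1) p" for x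
  proof
    show "x p \<le> 0" if "p \<in> F" for p
      by (rule field_le_epsilon) (use that \<open>\<forall>r>0. _\<close> in auto)
  qed
  show ?thesis
    unfolding order_unit_space_def quot_ous_sel
    by (intro conjI ballI allI impI bd zero unit_quot quot_add quot_scale)
       (simp_all add: algebra_simps mult_left_mono arch antisym, meson order_trans)
qed

lemma ous_norm_le:
  assumes "0 < r" "\<And>p. p \<in> F \<Longrightarrow> \<bar>x p\<bar> \<le> r"
  shows "ous_norm quot_ous x \<le> r"
  unfolding ous_norm_def
  by (rule cInf_lower) (use assms in \<open>auto simp: abs_le_iff minus_le_iff intro!: bdd_belowI[of _ 0]\<close>)

lemma qnorm_le_ous_norm:
  assumes x: "x \<in> quot T K F"
  shows "qnorm T K F x \<le> ous_norm quot_ous x"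
  unfolding ous_norm_def
proof (rule cInf_greatest)
  obtain r where "0 < r" "\<And>p. p \<in> F \<Longrightarrow> \<bar>x p\<bar> \<le> r" using quot_bounded[OF x] by blast
  then have "r \<in> {r. 0 < r \<and> ole quot_ous (osmul quot_ous (- r) (ounit quot_ous)) x \<and>
          ole quot_ous x (osmul quot_ous r (ounit quot_ous))}"
    by (auto simp: abs_le_iff minus_le_iff)
  then show "{r. 0 < r \<and> ole quot_ous (osmul quot_ous (- r) (ounit quot_ous)) x \<and>
          ole quot_ous x (osmul quot_ous r (ounit quot_ous))} \<noteq> {}" by blast
next
  fix r assume "r \<in> {r. 0 < r \<and> ole quot_ous (osmul quot_ous (- r) (ounit quot_ous)) x \<and>
          ole quot_ous x (osmul quot_ous r (ounit quot_ous))}"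
  then show "qnorm T K F x \<le> r" by (intro qnorm_le[OF x]) (auto simp: abs_le_iff minus_le_iff)
qed

lemma ous_norm_nonneg: "x \<in> quot T K F \<Longrightarrow> 0 \<le> ous_norm quot_ous x"
  using qnorm_le_ous_norm abs_le_qnorm F_nonempty by (meson abs_ge_zero all_not_in_conv order_trans)

subsection \<open>States and the retraction\<close>

text \<open>A minimiser over \<open>F\<close> of the sum of the squares of finitely many functions in the kernel of the
  state is a common zero: otherwise the derivative of that sum yields a function in the kernel that
  is bounded below by a positive constant.\<close>

lemma state_eq_evaluation_finite:
  assumes add: "\<And>a b. a \<in> AK T K \<Longrightarrow> b \<in> AK T K \<Longrightarrow> L (\<lambda>x. a x + b x) = L a + L b"
    and scale: "\<And>c a. a \<in> AK T K \<Longrightarrow> L (\<lambda>x. c * a x) = c * L a"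
    and unit: "L (restr K (\<lambda>_. 1)) = 1"
    and pos: "\<And>a. a \<in> AK T K \<Longrightarrow> (\<And>p. p \<in> F \<Longrightarrow> 0 \<le> a p) \<Longrightarrow> 0 \<le> L a"
    and I: "finite I" "I \<subseteq> AK T K"
  shows "\<exists>p\<in>F. \<forall>a\<in>I. a p = L a"
proof -
  let ?e = "restr K (\<lambda>_. 1)"
  have e: "?e \<in> AK T K" by (rule AK_const[OF convex_K])
  have e1: "?e p = 1" if "p \<in> F" for p using that F_subset by auto
  \<comment> \<open>Subtracting \<open>L a\<close> times the unit moves \<open>a\<close> into the
    kernel of \<open>L\<close>; a common zero in \<open>F\<close> of these functions is the required
    point.\<close>
  define c where "c a x = a x + - L a * ?e x" for a x
  have c: "c a \<in> AK T K" "L (c a) = 0" if "a \<in> I" for a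
  proof -
    have a: "a \<in> AK T K" using that I by blast
    have c_eq: "c a = (\<lambda>x. a x + - L a * ?e x)" by (simp add: c_def fun_eq_iff)
    show "c a \<in> AK T K" unfolding c_eq by (intro AK_add AK_scale a e)
    show "L (c a) = 0" unfolding c_eq add[OF a AK_scale[OF e]] scale[OF e] unit by simp
  qed
  have cK: "aff_on K (c a)" "continuous_map (subtopology T F) euclideanreal (c a)" if "a \<in> I" for a
    using AK_aff[OF c(1)[OF that]] continuous_map_from_subtopology_mono[OF AK_cont[OF c(1)[OF that]] F_subset] .
  define \<Phi> where "\<Phi> p = (\<Sum>a\<in>I. (c a p)\<^sup>2)" for p
  have "continuous_map (subtopology T F) euclideanreal \<Phi>"
    unfolding \<Phi>_def by (intro continuous_map_sum I continuous_map_real_pow cK)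
  then have "compactin euclideanreal (\<Phi> ` F)"
    by (rule image_compactin[rotated]) (use compact_F in \<open>simp add: compactin_subtopology\<close>)
  then have "compact (\<Phi> ` F)" by simp
  then obtain p where p: "p \<in> F" "\<And>q. q \<in> F \<Longrightarrow> \<Phi> p \<le> \<Phi> q"
    using compact_attains_inf[of "\<Phi> ` F"] F_nonempty by auto
  have "\<Phi> p = 0"
  proof (rule ccontr)
    assume "\<Phi> p \<noteq> 0"
    then have m: "\<Phi> p > 0" unfolding \<Phi>_def by (simp add: less_le sum_nonneg)
    \<comment> \<open>Up to a factor 2, \<open>b q - b p\<close> is the derivative of
      \<open>\<Phi>\<close> at \<open>p\<close> towards \<open>q\<close>, and
      \<open>b p = \<Phi> p\<close>. Since \<open>p\<close> is a minimiser, \<open>b\<close> is at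
      least \<open>\<Phi> p\<close> on \<open>F\<close>.\<close>
    define b where "b x = (\<Sum>a\<in>I. c a p * c a x)" for x
    have "b \<in> AK T K \<and> L b = 0"
      unfolding b_def using I(1) c
    proof (induction I)
      case empty
      have "L (\<lambda>x. 0 * ?e x) = 0 * L ?e" by (rule scale[OF e])
      then show ?case using AK_scale[OF e, of 0] by simp
    next
      case (insert a I)
      then have "(\<lambda>x. c a p * c a x) \<in> AK T K" "L (\<lambda>x. c a p * c a x) = 0"
        using AK_scale[of "c a"] scale[of "c a"] by auto
      then show ?case using insert add[of "\<lambda>x. c a p * c a x"] by (auto intro: AK_add)
    qed
    then have b: "b \<in> AK T K" "L b = 0" by auto
    have "\<Phi> p \<le> b q" if q: "q \<in> F" for q
    proof -
      define A where "A = (\<Sum>a\<in>I. c a p * (c a q - c a p))"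
      define B where "B = (\<Sum>a\<in>I. (c a q - c a p)\<^sup>2)"
      have B: "B \<ge> 0" unfolding B_def by (simp add: sum_nonneg)
      \<comment> \<open>On the segment from \<open>p\<close> to \<open>q\<close>,
        \<open>\<Phi>\<close> is the quadratic \<open>\<Phi> p + 2 * t * A + t\<^sup>2 * B\<close>;
        minimality at \<open>t = 0\<close> is divided by \<open>t\<close>.\<close>
      have key: "0 \<le> 2 * A + t * B" if t: "0 < t" "t \<le> 1" for t
      proof -
        let ?q = "(1 - t) *\<^sub>R p + t *\<^sub>R q"
        have "?q \<in> F" using convexD_alt[OF convex_F p(1) q, of t] t by simp
        then have "\<Phi> p \<le> \<Phi> ?q" by (rule p(2))
        also have "\<Phi> ?q = (\<Sum>a\<in>I. (c a p)\<^sup>2 + (2 * t) * (c a p * (c a q - c a p)) + t\<^sup>2 * (c a q - c a p)\<^sup>2)"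
          unfolding \<Phi>_def
        proof (rule sum.cong[OF refl])
          fix a assume a: "a \<in> I"
          have "p \<in> K" "q \<in> K" "t \<in> {0..1}" using p q t F_subset by auto
          then have eq: "c a ?q = (1 - t) * c a p + t * c a q"
            using cK(1)[OF a] unfolding aff_on_def by (metis real_scaleR_def)
          show "(c a ?q)\<^sup>2 = (c a p)\<^sup>2 + (2 * t) * (c a p * (c a q - c a p)) + t\<^sup>2 * (c a q - c a p)\<^sup>2"
            unfolding eq by (simp add: power2_eq_square algebra_simps)
        qed
        also have "\<dots> = \<Phi> p + (2 * t) * A + t\<^sup>2 * B"
          unfolding \<Phi>_def A_def B_def by (simp add: sum.distrib sum_distrib_left)
        finally have "0 \<le> t * (2 * A + t * B)" by (simp add: power2_eq_square algebra_simps)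
        then show ?thesis using t by (simp add: zero_le_mult_iff)
      qed
      have "A \<ge> 0"
      proof (rule ccontr)
        assume A: "\<not> A \<ge> 0"
        \<comment> \<open>This choice gives \<open>t * B \<le> - A\<close>, hence
          \<open>2 * A + t * B \<le> A < 0\<close>; the denominator \<open>B + 1\<close> stays
          positive when \<open>B = 0\<close>.\<close>
        define t where "t = min 1 (- A / (B + 1))"
        have t: "0 < t" "t \<le> 1" "t \<le> - A / (B + 1)" unfolding t_def using A B by (auto simp: field_simps)
        have "t * B \<le> t * (B + 1)" using t by simp
        also have "\<dots> \<le> - A" using t(3) B by (simp add: field_simps)
        finally show False using key[OF t(1,2)] A by simp
      qed
      moreover have "b q = \<Phi> p + A"
        unfolding b_def \<Phi>_def A_def by (simp add: sum.distrib[symmetric] power2_eq_square algebra_simps)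
      ultimately show ?thesis by simp
    qed
    then have "0 \<le> L (\<lambda>x. b x + - \<Phi> p * ?e x)"
      using e1 by (intro pos AK_add AK_scale b e) auto
    also have "\<dots> = - \<Phi> p" unfolding add[OF b(1) AK_scale[OF e]] scale[OF e] unit b(2) by simp
    finally show False using m by simp
  qed
  then have "\<forall>a\<in>I. (c a p)\<^sup>2 = 0" unfolding \<Phi>_def using I(1) by (subst (asm) sum_nonneg_eq_0_iff) auto
  then have "\<forall>a\<in>I. a p = L a" using e1[OF p(1)] by (simp add: c_def)
  then show ?thesis using p by blast
qed

text \<open>The closed sets where \<open>a p = L a\<close> have the finite intersection property by
  the finite case, and \<open>F\<close> is compact.\<close>

lemma state_eq_evaluation:
  assumes "\<And>a b. a \<in> AK T K \<Longrightarrow> b \<in> AK T K \<Longrightarrow> L (\<lambda>x. a x + b x) = L a + L b"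
    and "\<And>c a. a \<in> AK T K \<Longrightarrow> L (\<lambda>x. c * a x) = c * L a"
    and "L (restr K (\<lambda>_. 1)) = 1"
    and "\<And>a. a \<in> AK T K \<Longrightarrow> (\<And>p. p \<in> F \<Longrightarrow> 0 \<le> a p) \<Longrightarrow> 0 \<le> L a"
  shows "\<exists>p\<in>F. \<forall>a\<in>AK T K. a p = L a"
proof -
  define Z where "Z a = {p \<in> F. a p = L a}" for a
  have "closedin T (Z a)" if "a \<in> AK T K" for a
  proof -
    have "closedin (subtopology T F) {p \<in> topspace (subtopology T F). a p \<in> {L a}}"
      by (rule closedin_continuous_map_preimage[OF continuous_map_from_subtopology_mono[OF AK_cont[OF that] F_subset]]) simp
    then have "closedin (subtopology T F) (Z a)" using lcs_topspace[OF lcs] by (simp add: Z_def)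
    then show ?thesis using closed_F by (rule closedin_trans_full)
  qed
  moreover have "F \<inter> \<Inter>\<F> \<noteq> {}" if fin: "finite \<F>" "\<F> \<subseteq> Z ` AK T K" for \<F>
  proof -
    obtain I where I: "finite I" "I \<subseteq> AK T K" "\<F> = Z ` I" using finite_subset_image[OF fin] by blast
    then obtain p where "p \<in> F" "\<forall>a\<in>I. a p = L a" using state_eq_evaluation_finite[OF assms I(1,2)] by blast
    then show ?thesis unfolding I(3) Z_def by blast
  qed
  ultimately have "F \<inter> \<Inter>(Z ` AK T K) \<noteq> {}"
    using compact_F unfolding compactin_fip by (metis (no_types, lifting) imageE)
  then show ?thesis unfolding Z_def by blast
qed

end

text \<open>The preimage of a closed \<open>C\<close> is the projection of the part of the graph
  over \<open>C\<close>, and projection along a compact factor is a closed map.\<close>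

lemma continuous_map_closed_graph:
  assumes Y: "compact_space Y" and f: "f \<in> topspace X \<rightarrow> topspace Y"
    and graph: "closedin (prod_topology X Y) {(x, y) \<in> topspace X \<times> topspace Y. y = f x}"
  shows "continuous_map X Y f"
  unfolding continuous_map_closedin
proof (intro conjI allI impI f)
  fix C assume C: "closedin Y C"
  let ?Z = "{(x, y) \<in> topspace X \<times> topspace Y. y = f x} \<inter> (topspace X \<times> C)"
  have "closedin (prod_topology X Y) ?Z"
    using C graph by (intro closedin_Int) (auto simp: closedin_prod_Times_iff)
  then have "closedin X (fst ` ?Z)" using closed_map_fst[OF Y] unfolding closed_map_def by blast
  moreover have "fst ` ?Z = {x \<in> topspace X. f x \<in> C}" using f by force
  ultimately show "closedin X {x \<in> topspace X. f x \<in> C}" by simp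
qed

section \<open>The retraction and the lifting of operators\<close>

context split_face_space
begin

text \<open>The identity of the quotient has norm at most 1, so its norm-preserving lift does too.
  Since the unit has order unit norm at most 1, the lift sends it to a function bounded by 1 on
  \<open>K\<close>.\<close>

lemma pos_lifting_unit_le_one:
  assumes "pos_lifting T K F"
  obtains S where "\<And>x. x \<in> quot T K F \<Longrightarrow> S x \<in> AK T K"
    "\<And>x y p. x \<in> quot T K F \<Longrightarrow> y \<in> quot T K F \<Longrightarrow> S (\<lambda>p. x p + y p) p = S x p + S y p"
    "\<And>c x p. x \<in> quot T K F \<Longrightarrow> S (\<lambda>p. c * x p) p = c * S x p"
    "\<And>x p. x \<in> quot T K F \<Longrightarrow> (\<And>p. p \<in> F \<Longrightarrow> 0 \<le> x p) \<Longrightarrow> p \<in> K \<Longrightarrow> 0 \<le> S x p"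
    "\<And>x. x \<in> quot T K F \<Longrightarrow> restr F (S x) = x"
    "\<And>p. p \<in> K \<Longrightarrow> S (restr F (\<lambda>_. 1)) p \<le> 1"
proof -
  let ?E = quot_ous and ?S = "\<lambda>x :: 'a \<Rightarrow> real. x"
  have "ous_linear ?E ?S" by (simp add: ous_linear_def)
  moreover have "\<forall>x\<in>oc ?E. ?S x \<in> quot T K F" by simp
  moreover have "\<forall>x\<in>oc ?E. ole ?E (ozero ?E) x \<longrightarrow> (\<forall>p\<in>F. ?S x p \<ge> 0)" by simp
  moreover have "\<exists>C. \<forall>x\<in>oc ?E. qnorm T K F (?S x) \<le> C * ous_norm ?E x"
    by (rule exI[of _ 1]) (simp add: qnorm_le_ous_norm)
  ultimately obtain S where lin: "ous_linear ?E S" and SK: "\<forall>x\<in>oc ?E. S x \<in> AK T K"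
    and pos: "\<forall>x\<in>oc ?E. ole ?E (ozero ?E) x \<longrightarrow> (\<forall>p\<in>K. S x p \<ge> 0)"
    and bd: "\<exists>C. \<forall>x\<in>oc ?E. supK K (S x) \<le> C * ous_norm ?E x"
    and lift: "\<forall>x\<in>oc ?E. restr F (S x) = x"
    and norm: "opnorm_on (oc ?E) (ous_norm ?E) (supK K) S = opnorm_on (oc ?E) (ous_norm ?E) (qnorm T K F) ?S"
    using assms order_unit_space_quot unfolding pos_lifting_def by blast
  let ?B = "{C. C \<ge> 0 \<and> (\<forall>x\<in>oc ?E. supK K (S x) \<le> C * ous_norm ?E x)}"
  have "opnorm_on (oc ?E) (ous_norm ?E) (qnorm T K F) ?S \<le> 1"
    unfolding opnorm_on_def
    by (rule cInf_lower) (auto simp: qnorm_le_ous_norm intro!: bdd_belowI[of _ 0])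
  then have inf: "Inf ?B \<le> 1" using norm unfolding opnorm_on_def by simp
  obtain C where C: "\<forall>x\<in>oc ?E. supK K (S x) \<le> C * ous_norm ?E x" using bd by blast
  \<comment> \<open>The bound supplied by the lifting may be negative; raising it to at least 0
    shows that the set defining the operator norm is nonempty, as needed to approach its
    infimum.\<close>
  have "supK K (S x) \<le> max C 0 * ous_norm ?E x" if "x \<in> oc ?E" for x
  proof -
    have "supK K (S x) \<le> C * ous_norm ?E x" using C that by blast
    also have "\<dots> \<le> max C 0 * ous_norm ?E x"
      using ous_norm_nonneg that by (intro mult_right_mono) auto
    finally show ?thesis .
  qed
  then have ne: "max C 0 \<in> ?B" by auto
  let ?u = "restr F (\<lambda>_. 1 :: real)"
  have "S ?u p \<le> 1" if p: "p \<in> K" for p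
  proof (rule field_le_epsilon)
    fix e :: real assume "0 < e"
    then have "Inf ?B < 1 + e" using inf by linarith
    then obtain D where D: "D \<in> ?B" "D < 1 + e" using cInf_lessD[of ?B "1 + e"] ne by blast
    have "S ?u p \<le> supK K (S ?u)" using le_supK[of "S ?u" p] SK unit_quot[of 1] p by auto
    also have "\<dots> \<le> D * ous_norm ?E ?u" using D unit_quot[of 1] by simp
    also have "\<dots> \<le> D * 1" using D by (intro mult_left_mono ous_norm_le) auto
    finally show "S ?u p \<le> 1 + e" using D by simp
  qed
  then show ?thesis using that[of S] lin SK pos lift unfolding ous_linear_def by simp
qed

text \<open>The point \<open>\<phi> k\<close> represents the state \<open>L k\<close>. Since A(K)
  separates points, the algebraic properties of \<open>\<phi>\<close> are inherited from those of
  \<open>k \<mapsto> L k a\<close>, and its graph is cut out by the equations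
  \<open>a y = L x a\<close>, which makes it closed.\<close>

theorem pos_lifting_imp_retraction:
  assumes "pos_lifting T K F"
  obtains \<phi> where "continuous_map (subtopology T K) (subtopology T F) \<phi>" "aff_on K \<phi>"
    "\<And>k. k \<in> F \<Longrightarrow> \<phi> k = k"
proof -
  obtain S where SK: "\<And>x. x \<in> quot T K F \<Longrightarrow> S x \<in> AK T K"
    and Sadd: "\<And>x y p. x \<in> quot T K F \<Longrightarrow> y \<in> quot T K F \<Longrightarrow> S (\<lambda>p. x p + y p) p = S x p + S y p"
    and Sscale: "\<And>c x p. x \<in> quot T K F \<Longrightarrow> S (\<lambda>p. c * x p) p = c * S x p"
    and Spos: "\<And>x p. x \<in> quot T K F \<Longrightarrow> (\<And>p. p \<in> F \<Longrightarrow> 0 \<le> x p) \<Longrightarrow> p \<in> K \<Longrightarrow> 0 \<le> S x p"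
    and Slift: "\<And>x. x \<in> quot T K F \<Longrightarrow> restr F (S x) = x"
    and Sunit: "\<And>p. p \<in> K \<Longrightarrow> S (restr F (\<lambda>_. 1)) p \<le> 1"
    using pos_lifting_unit_le_one[OF assms] by blast
  obtain p0 where p0: "p0 \<in> F" using F_nonempty by blast
  let ?u = "restr F (\<lambda>_. 1 :: real)"
  \<comment> \<open>The lift need not preserve the unit on \<open>K\<close>; the missing mass is placed at \<open>p0\<close>.\<close>
  define L where "L k a = S (restr F a) k + (1 - S ?u k) * a p0" for k a
  have "\<exists>p\<in>F. \<forall>a\<in>AK T K. a p = L k a" if k: "k \<in> K" for k
  proof (rule state_eq_evaluation)
    show "L k (\<lambda>x. a x + b x) = L k a + L k b" if "a \<in> AK T K" "b \<in> AK T K" for a b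
      unfolding L_def restr_add using Sadd[OF restr_quot[OF that(1)] restr_quot[OF that(2)]]
      by (simp add: algebra_simps)
    show "L k (\<lambda>x. c * a x) = c * L k a" if "a \<in> AK T K" for c a
      unfolding L_def restr_scale using Sscale[OF restr_quot[OF that]] by (simp add: algebra_simps)
    show "L k (restr K (\<lambda>_. 1)) = 1"
      unfolding L_def restr_restr using p0 F_subset by auto
    show "0 \<le> L k a" if a: "a \<in> AK T K" "\<And>p. p \<in> F \<Longrightarrow> 0 \<le> a p" for a
    proof -
      have "0 \<le> S (restr F a) k" using Spos[OF restr_quot[OF a(1)] _ k] a(2) by simp
      moreover have "0 \<le> (1 - S ?u k) * a p0" using Sunit[OF k] a(2)[OF p0] by simp
      ultimately show ?thesis unfolding L_def by simp
    qed
  qed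
  then obtain \<phi> where \<phi>F: "\<And>k. k \<in> K \<Longrightarrow> \<phi> k \<in> F"
    and \<phi>: "\<And>k a. k \<in> K \<Longrightarrow> a \<in> AK T K \<Longrightarrow> a (\<phi> k) = L k a" by metis
  have \<phi>K: "\<phi> k \<in> K" if "k \<in> K" for k using \<phi>F[OF that] F_subset by blast
  have L_AK: "restr K (\<lambda>k. L k a) \<in> AK T K" if a: "a \<in> AK T K" for a
  proof -
    have "(\<lambda>k. S (restr F a) k + (a p0 * restr K (\<lambda>_. 1) k + - a p0 * S ?u k)) \<in> AK T K"
      by (intro AK_add[OF SK[OF restr_quot[OF a]]] AK_add[OF AK_scale[OF AK_const[OF convex_K]]]
          AK_scale[OF SK[OF unit_quot]])
    moreover have "restr K (\<lambda>k. L k a) = (\<lambda>k. S (restr F a) k + (a p0 * restr K (\<lambda>_. 1) k + - a p0 * S ?u k))"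
    proof
      show "restr K (\<lambda>k. L k a) k = S (restr F a) k + (a p0 * restr K (\<lambda>_. 1) k + - a p0 * S ?u k)" for k
        using AK_outside[OF SK[OF restr_quot[OF a]], of k] AK_outside[OF SK[OF unit_quot[of 1]], of k]
        by (cases "k \<in> K") (auto simp: L_def algebra_simps)
    qed
    ultimately show ?thesis by simp
  qed
  have top: "topspace (subtopology T K) = K" "topspace (subtopology T F) = F" using lcs_topspace[OF lcs] by auto
  show ?thesis
  proof (rule that)
    show "\<phi> k = k" if k: "k \<in> F" for k
    proof (rule AK_separates)
      show "k \<in> K" "\<phi> k \<in> K" using k F_subset \<phi>K by auto
      show "a (\<phi> k) = a k" if a: "a \<in> AK T K" for a
      proof -
        \<comment> \<open>On \<open>F\<close> the lift reproduces the quotient element. In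
          particular the unit has value 1 at \<open>k\<close>, so the correction at
          \<open>p0\<close> disappears.\<close>
        have eq: "S x k = x k" if "x \<in> quot T K F" for x
          using Slift[OF that] k by (metis restr_in)
        show ?thesis using \<phi>[OF \<open>k \<in> K\<close> a] eq[OF restr_quot[OF a]] eq[OF unit_quot[of 1]] k unfolding L_def by simp
      qed
    qed
    show "aff_on K \<phi>"
      unfolding aff_on_def
    proof (intro ballI)
      fix x y and t :: real assume h: "x \<in> K" "y \<in> K" "t \<in> {0..1}"
      have comb: "(1 - t) *\<^sub>R x + t *\<^sub>R y \<in> K" "(1 - t) *\<^sub>R \<phi> x + t *\<^sub>R \<phi> y \<in> K"
        using convexD_alt[OF convex_K] h \<phi>K by auto
      show "\<phi> ((1 - t) *\<^sub>R x + t *\<^sub>R y) = (1 - t) *\<^sub>R \<phi> x + t *\<^sub>R \<phi> y"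
      proof (rule AK_separates[OF \<phi>K[OF comb(1)] comb(2)])
        fix a assume a: "a \<in> AK T K"
        have "a (\<phi> ((1 - t) *\<^sub>R x + t *\<^sub>R y)) = (1 - t) *\<^sub>R L x a + t *\<^sub>R L y a"
          using AK_aff[OF L_AK[OF a], unfolded aff_on_def, rule_format, OF h] \<phi>[OF comb(1) a] comb(1) h(1,2)
          by simp
        also have "\<dots> = (1 - t) *\<^sub>R a (\<phi> x) + t *\<^sub>R a (\<phi> y)" using \<phi> a h by simp
        also have "\<dots> = a ((1 - t) *\<^sub>R \<phi> x + t *\<^sub>R \<phi> y)" using AK_aff[OF a] h \<phi>K unfolding aff_on_def by simp
        finally show "a (\<phi> ((1 - t) *\<^sub>R x + t *\<^sub>R y)) = a ((1 - t) *\<^sub>R \<phi> x + t *\<^sub>R \<phi> y)" .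
      qed
    qed
    show "continuous_map (subtopology T K) (subtopology T F) \<phi>"
    proof (rule continuous_map_closed_graph)
      let ?X = "subtopology T K" and ?Y = "subtopology T F"
      show "compact_space ?Y" using compact_F by (simp add: compactin_subspace)
      show "\<phi> \<in> topspace ?X \<rightarrow> topspace ?Y" using \<phi>F unfolding top by blast
      define D where "D a z = a (snd z) - restr K (\<lambda>k. L k a) (fst z)"
        for a and z :: "'a \<times> 'a"
      have "closedin (prod_topology ?X ?Y) {z \<in> topspace (prod_topology ?X ?Y). D a z \<in> {0}}" if a: "a \<in> AK T K" for a
      proof (rule closedin_continuous_map_preimage)
        have "continuous_map (prod_topology ?X ?Y) euclideanreal (a \<circ> snd)"
          by (rule continuous_map_compose[OF continuous_map_snd])
             (rule continuous_map_from_subtopology_mono[OF AK_cont[OF a] F_subset])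
        moreover have "continuous_map (prod_topology ?X ?Y) euclideanreal (restr K (\<lambda>k. L k a) \<circ> fst)"
          by (rule continuous_map_compose[OF continuous_map_fst AK_cont[OF L_AK[OF a]]])
        ultimately show "continuous_map (prod_topology ?X ?Y) euclideanreal (D a)"
          unfolding D_def o_def by (rule continuous_map_diff)
      qed simp
      moreover have "AK T K \<noteq> {}" using AK_const[OF convex_K] by blast
      ultimately have "closedin (prod_topology ?X ?Y) (\<Inter>a\<in>AK T K. {z \<in> topspace (prod_topology ?X ?Y). D a z \<in> {0}})"
        by (intro closedin_INT) auto
      also have "(\<Inter>a\<in>AK T K. {z \<in> topspace (prod_topology ?X ?Y). D a z \<in> {0}}) =
          {(x, y) \<in> topspace ?X \<times> topspace ?Y. y = \<phi> x}"
      proof -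
        have "(\<forall>a\<in>AK T K. D a (x, y) = 0) \<longleftrightarrow> y = \<phi> x" if "x \<in> K" "y \<in> F" for x y
        proof -
          have D: "D a (x, y) = a y - L x a" for a unfolding D_def using that(1) by simp
          have "y \<in> K" using that F_subset by blast
          then show ?thesis unfolding D using AK_separates[OF _ \<phi>K[OF that(1)], of y] \<phi>[OF that(1)] by auto
        qed
        then show ?thesis using \<open>AK T K \<noteq> {}\<close> unfolding topspace_prod_topology top by fastforce
      qed
      finally show "closedin (prod_topology ?X ?Y) {(x, y) \<in> topspace ?X \<times> topspace ?Y. y = \<phi> x}" .
    qed
  qed
qed

text \<open>Composition with \<open>\<phi>\<close> takes only values attained on \<open>F\<close>,
  so \<open>supK K (R y)\<close> is at most the quotient norm of \<open>S y\<close>. The reverse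
  inequality holds because \<open>R y\<close> represents \<open>S y\<close>; hence norms agree for
  each \<open>y\<close>, and so do the operator norms.\<close>

theorem retraction_imp_qlp:
  assumes cont: "continuous_map (subtopology T K) (subtopology T F) \<phi>" and aff: "aff_on K \<phi>"
    and id: "\<And>k. k \<in> F \<Longrightarrow> \<phi> k = k"
  shows "qlp T K F TYPE('y::banach)"
  unfolding qlp_def
proof (intro allI impI, elim conjE)
  fix S :: "'y \<Rightarrow> 'a \<Rightarrow> real"
  assume SQ: "\<forall>y. S y \<in> quot T K F" and add: "\<forall>y1 y2 p. S (y1 + y2) p = S y1 p + S y2 p"
    and scale: "\<forall>c y p. S (c *\<^sub>R y) p = c * S y p" and bd: "\<exists>C. \<forall>y. qnorm T K F (S y) \<le> C * norm y"
  have \<phi>F: "\<phi> k \<in> F" if "k \<in> K" for k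
    using continuous_map_image_subset_topspace[OF cont] that lcs_topspace[OF lcs] by auto
  define R where "R y = restr K (S y \<circ> \<phi>)" for y
  have RK: "R y \<in> AK T K" for y
  proof -
    obtain a where a: "a \<in> AK T K" "S y = restr F a" using SQ quotE by blast
    have "R y = restr K (a \<circ> \<phi>)" unfolding R_def restr_eq_iff a(2) using \<phi>F by simp
    moreover have "continuous_map (subtopology T K) euclideanreal (a \<circ> \<phi>)"
      by (rule continuous_map_compose[OF cont continuous_map_from_subtopology_mono[OF AK_cont[OF a(1)] F_subset]])
    moreover have "aff_on K (a \<circ> \<phi>)"
      using aff AK_aff[OF a(1)] \<phi>F F_subset unfolding aff_on_def by (simp add: subset_iff)
    ultimately show ?thesis using restr_AK[OF convex_K] by metis
  qed
  have lift: "restr F (R y) = S y" for y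
  proof
    show "restr F (R y) p = S y p" for p
      using id F_subset quot_outside SQ unfolding R_def by (cases "p \<in> F") auto
  qed
  have "supK K (R y) \<le> qnorm T K F (S y)" for y
    by (rule supK_le) (use abs_le_qnorm SQ \<phi>F in \<open>auto simp: R_def\<close>)
  then have norm: "supK K (R y) = qnorm T K F (S y)" for y
    using qnorm_le_supK[OF RK[of y]] lift by (metis order_antisym)
  have "R (y1 + y2) p = R y1 p + R y2 p" for y1 y2 p using add by (auto simp: R_def restr_def)
  moreover have "R (c *\<^sub>R y) p = c * R y p" for c y p using scale by (auto simp: R_def restr_def)
  ultimately show "\<exists>R. (\<forall>y. R y \<in> AK T K) \<and> (\<forall>y1 y2 p. R (y1 + y2) p = R y1 p + R y2 p) \<and>
      (\<forall>c y p. R (c *\<^sub>R y) p = c * R y p) \<and> (\<exists>C. \<forall>y. supK K (R y) \<le> C * norm y) \<and>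
      (\<forall>y. restr F (R y) = S y) \<and>
      opnorm_on UNIV norm (supK K) R = opnorm_on UNIV norm (qnorm T K F) S"
    using RK lift bd norm by (intro exI[of _ R]) (auto simp: opnorm_on_def)
qed

end

theorem theorem6:
  fixes T :: "'a::real_vector topology" and K F :: "'a set"
  assumes "locally_convex_space T"
    and "compactin T K" and "convex K"
    and "split_face K F" and "closedin T F" and "F \<noteq> {}"
    and "pos_lifting T K F"
  shows "(\<exists>\<phi>. continuous_map (subtopology T K) (subtopology T F) \<phi> \<and> aff_on K \<phi> \<and>
              (\<forall>k\<in>F. \<phi> k = k))
         \<and> qlp T K F TYPE('y::banach)"
proof -
  interpret split_face_space T K F
    by unfold_locales (use assms in auto)
  show ?thesis
    using pos_lifting_imp_retraction[OF assms(7)] retraction_imp_qlp by metis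
qed

end
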